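(* Let $T=\bigoplus_{\gamma\in G}T_\gamma$ be a Lie color triple system over a field $\mathbf{K}$ of characteristic $p>3$. Suppose that for every $\gamma\in G_+$ there exists a basis $(u_{i,\gamma})_{i\in J_\gamma}$ of $T_\gamma$ such that for every $i\in J_\gamma$ there is $v_{i,\gamma}\in T_{p\gamma}$ with $$[a,v_{i,\gamma},c]=(a,u_{i,\gamma},\dots,u_{i,\gamma},c)\qquad\text{for all }a,c\in T,$$ where $u_{i,\gamma}$ occurs $p$ times on the right. Then there is a unique restricted structure on $T$ such that $u_{i,\gamma}^{[p]}=v_{i,\gamma}$ for all $\gamma\in G_+$ and all $i\in J_\gamma$.
   Context: $(G,+)$ is an abelian group and $\varepsilon:G\times G\to\mathbf{K}^*$ is a bicharacter: $\varepsilon(\alpha+\beta,\gamma)=\varepsilon(\alpha,\gamma)\varepsilon(\beta,\gamma)$, $\varepsilon(\alpha,\beta+\gamma)=\varepsilon(\alpha,\beta)\varepsilon(\alpha,\gamma)$, $\varepsilon(\alpha,\beta)\varepsilon(\beta,\alpha)=1$. $G_+=\{\gamma:\varepsilon(\gamma,\gamma)=1\}$. $\bar x$ is the degree of a homogeneous element $x$. Lie color triple system: $G$-graded space $T$ with trilinear $[\cdot,\cdot,\cdot]$ such that $[T_i,T_j,T_k]\subset T_{i+j+k}$ and for homogeneous elements: $[x,y,z]=-\varepsilon(\bar x,\bar y)[y,x,z]$; $\varepsilon(\bar z,\bar x)[x,y,z]+\varepsilon(\bar x,\bar y)[y,z,x]+\varepsilon(\bar y,\bar z)[z,x,y]=0$;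 $[u,v,[x,y,z]]=[[u,v,x],y,z]+\varepsilon(\bar u+\bar v,\bar x)[x,[u,v,y],z]+\varepsilon(\bar u+\bar v,\bar x+\bar y)[x,y,[u,v,z]]$. For odd $n\ge 3$, $(x_1,\dots,x_n)=[[\cdots[[x_1,x_2,x_3],x_4,x_5],\cdots],x_{n-1},x_n]$. A restricted structure on $T$ is a family of maps $(\cdot)^{[p]}:T_\gamma\to T_{p\gamma}$, $\gamma\in G_+$, such that for all $\gamma\in G_+$: $(\alpha x)^{[p]}=\alpha^px^{[p]}$ for $\alpha\in\mathbf{K}$, $x\in T_\gamma$; $(x+y)^{[p]}=x^{[p]}+y^{[p]}+\sum_{i=1}^{p-1}s_i(x,y)$ for $x,y\in T_\gamma$, where $i s_i(x,y)$ is the coefficient of $Z^{i-1}$ in the polynomial $(x,Zx+y,\dots,Zx+y)$ ($Zx+y$ occurring $p-1$ times); $[x,y^{[p]},z]=(x,y,\dots,y,z)$ ($p$ copies of $y$) for $y\in T_\gamma$ and $x,z\in T$. *)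

theory Defs
  imports "HOL-Library.FuncSet" "HOL-Computational_Algebra.Computational_Algebra"
begin

text \<open>The multiple \<open>n\<gamma>\<close> in an abelian group.\<close>

definition nat_mult :: "nat \<Rightarrow> 'g::ab_group_add \<Rightarrow> 'g"
  where "nat_mult n \<gamma> = (\<Sum>_<n. \<gamma>)"

locale bicharacter =
  fixes \<epsilon> :: "'g::ab_group_add \<Rightarrow> 'g \<Rightarrow> 'k::field"
  assumes nonzero: "\<epsilon> \<alpha> \<beta> \<noteq> 0"
    and add_left: "\<epsilon> (\<alpha> + \<beta>) \<gamma> = \<epsilon> \<alpha> \<gamma> * \<epsilon> \<beta> \<gamma>"
    and add_right: "\<epsilon> \<alpha> (\<beta> + \<gamma>) = \<epsilon> \<alpha> \<beta> * \<epsilon> \<alpha> \<gamma>"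
    and mult_swap: "\<epsilon> \<alpha> \<beta> * \<epsilon> \<beta> \<alpha> = 1"

definition G_plus :: "('g::ab_group_add \<Rightarrow> 'g \<Rightarrow> 'k::field) \<Rightarrow> 'g set"
  where "G_plus \<epsilon> = {\<gamma>. \<epsilon> \<gamma> \<gamma> = 1}"

context vector_space
begin

text \<open>The whole type \<^typ>\<open>'b\<close> is the internal direct sum of the subspaces \<open>T \<gamma>\<close>;
  \<open>f\<close> is the family of homogeneous components of \<open>x\<close>.\<close>

definition grading :: "('g \<Rightarrow> 'b set) \<Rightarrow> bool"
  where "grading T \<longleftrightarrow>
    (\<forall>\<gamma>. subspace (T \<gamma>)) \<and>
    (\<forall>x. \<exists>!f. finite {\<gamma>. f \<gamma> \<noteq> 0} \<and> (\<forall>\<gamma>. f \<gamma> \<in> T \<gamma>) \<and> x = (\<Sum>\<gamma> | f \<gamma> \<noteq> 0. f \<gamma>))"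

definition trilinear :: "('b \<Rightarrow> 'b \<Rightarrow> 'b \<Rightarrow> 'b) \<Rightarrow> bool"
  where "trilinear br \<longleftrightarrow>
    (\<forall>y z. Vector_Spaces.linear scale scale (\<lambda>x. br x y z)) \<and>
    (\<forall>x z. Vector_Spaces.linear scale scale (\<lambda>y. br x y z)) \<and>
    (\<forall>x y. Vector_Spaces.linear scale scale (\<lambda>z. br x y z))"

definition basis_family :: "'i set \<Rightarrow> ('i \<Rightarrow> 'b) \<Rightarrow> 'b set \<Rightarrow> bool"
  where "basis_family J u V \<longleftrightarrow> inj_on u J \<and> independent (u ` J) \<and> span (u ` J) = V"

end

locale lie_color_triple_system = vector_space scale + bicharacter \<epsilon>
  for scale :: "'k::field \<Rightarrow> 'v::ab_group_add \<Rightarrow> 'v" (infixr "*s" 75)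
    and \<epsilon> :: "'g::ab_group_add \<Rightarrow> 'g \<Rightarrow> 'k" +
  fixes T :: "'g \<Rightarrow> 'v set"
    and br :: "'v \<Rightarrow> 'v \<Rightarrow> 'v \<Rightarrow> 'v"
  assumes grading: "grading T"
    and trilinear: "trilinear br"
    and br_in: "x \<in> T i \<Longrightarrow> y \<in> T j \<Longrightarrow> z \<in> T k \<Longrightarrow> br x y z \<in> T (i + j + k)"
    and br_skew: "x \<in> T i \<Longrightarrow> y \<in> T j \<Longrightarrow> z \<in> T k \<Longrightarrow> br x y z = - (\<epsilon> i j *s br y x z)"
    and br_cyclic: "x \<in> T i \<Longrightarrow> y \<in> T j \<Longrightarrow> z \<in> T k \<Longrightarrow>
      \<epsilon> k i *s br x y z + \<epsilon> i j *s br y z x + \<epsilon> j k *s br z x y = 0"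
    and br_derivation: "u \<in> T l \<Longrightarrow> v \<in> T m \<Longrightarrow> x \<in> T i \<Longrightarrow> y \<in> T j \<Longrightarrow> z \<in> T k \<Longrightarrow>
      br u v (br x y z) = br (br u v x) y z + \<epsilon> (l + m) i *s br x (br u v y) z
        + \<epsilon> (l + m) (i + j) *s br x y (br u v z)"

text \<open>The iterated product \<open>(x\<^sub>1, \<dots>, x\<^sub>n)\<close>; only lists of odd length are meaningful.\<close>

fun iter_br :: "('a \<Rightarrow> 'a \<Rightarrow> 'a \<Rightarrow> 'a) \<Rightarrow> 'a list \<Rightarrow> 'a"
  where
    "iter_br br [x] = x"
  | "iter_br br (x # y # z # xs) = iter_br br (br x y z # xs)"

text \<open>\<open>T[Z]\<close> is represented by \<^typ>\<open>'v poly\<close>, with \<^typ>\<open>'v\<close> only an abelian group; this is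
  the \<open>Z\<close>-linear extension of the triple product to it.\<close>

definition poly_br ::
  "('v::ab_group_add \<Rightarrow> 'v \<Rightarrow> 'v \<Rightarrow> 'v) \<Rightarrow> 'v poly \<Rightarrow> 'v poly \<Rightarrow> 'v poly \<Rightarrow> 'v poly"
  where "poly_br br P Q R =
    (\<Sum>i\<le>degree P. \<Sum>j\<le>degree Q. \<Sum>k\<le>degree R.
      monom (br (coeff P i) (coeff Q j) (coeff R k)) (i + j + k))"

text \<open>\<open>jacobson_s scale br p i x y\<close> is \<open>s\<^sub>i(x, y)\<close>; in characteristic \<open>p\<close> the number
  \<open>i \<in> {1, \<dots>, p - 1}\<close> is invertible. The polynomial \<open>Zx + y\<close> is \<^term>\<open>[:y, x:]\<close>.\<close>

definition jacobson_s ::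
  "('k::field \<Rightarrow> 'v::ab_group_add \<Rightarrow> 'v) \<Rightarrow> ('v \<Rightarrow> 'v \<Rightarrow> 'v \<Rightarrow> 'v) \<Rightarrow> nat \<Rightarrow> nat \<Rightarrow> 'v \<Rightarrow> 'v \<Rightarrow> 'v"
  where "jacobson_s scale br p i x y =
    scale (inverse (of_nat i))
      (coeff (iter_br (poly_br br) ([:x:] # replicate (p - 1) [:y, x:])) (i - 1))"

text \<open>A restricted structure is a family of maps \<open>P \<gamma> : T \<gamma> \<rightarrow> T (p\<gamma>)\<close> indexed by
  \<open>\<gamma> \<in> G\<^sub>+\<close>. Taking extensional functions makes such a family determined by its values on
  these domains, so that equality of families is equality in HOL.\<close>

definition restricted_structure ::
  "nat \<Rightarrow> ('k::field \<Rightarrow> 'v::ab_group_add \<Rightarrow> 'v) \<Rightarrow> ('g::ab_group_add \<Rightarrow> 'g \<Rightarrow> 'k) \<Rightarrow>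
   ('g \<Rightarrow> 'v set) \<Rightarrow> ('v \<Rightarrow> 'v \<Rightarrow> 'v \<Rightarrow> 'v) \<Rightarrow> ('g \<Rightarrow> 'v \<Rightarrow> 'v) \<Rightarrow> bool"
  where "restricted_structure p scale \<epsilon> T br P \<longleftrightarrow>
    P \<in> (\<Pi>\<^sub>E \<gamma>\<in>G_plus \<epsilon>. T \<gamma> \<rightarrow>\<^sub>E T (nat_mult p \<gamma>)) \<and>
    (\<forall>\<gamma>\<in>G_plus \<epsilon>.
      (\<forall>\<alpha>. \<forall>x\<in>T \<gamma>. P \<gamma> (scale \<alpha> x) = scale (\<alpha> ^ p) (P \<gamma> x)) \<and>
      (\<forall>x\<in>T \<gamma>. \<forall>y\<in>T \<gamma>.
        P \<gamma> (x + y) = P \<gamma> x + P \<gamma> y + (\<Sum>i = 1..p - 1. jacobson_s scale br p i x y)) \<and>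
      (\<forall>y\<in>T \<gamma>. \<forall>x z. br x (P \<gamma> y) z = iter_br br (x # replicate p y @ [z])))"

end

(*
Fix \<gamma> with \<epsilon>(\<gamma>, \<gamma>) = 1. On the subsystem generated by T \<gamma> all signs are trivial, so it is an ordinary
Lie triple system, and it acts on T by right multiplications. In it the one-form
\<omega>\<^sub>y(h) = (h, y, ..., y), with p - 1 copies of y, is closed in characteristic p: formally it is d(y\<^sup>p). Since
S(x, y) = s\<^sub>1(x, y) + ... + s\<^bsub>p-1\<^esub>(x, y) is the formal integral of \<omega> along the segment from y to x + y, every
derivation d satisfies d(S(x, y)) = \<omega>\<^bsub>x+y\<^esub>(d(x + y)) - \<omega>\<^sub>x(d x) - \<omega>\<^sub>y(d y). For d/ds on the polynomial
extension, this shows that the defects of symmetry and of the cocycle identity of S, with x replaced by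
s x, have derivative 0; they have degree less than p in s and vanish at s = 0, so they vanish. Thus no
embedding into an associative algebra is needed. A symmetric cocycle that is homogeneous of degree p and
vanishes on lines defines a vector space extension of T \<gamma>, and the [p]-map is the linear section of this
extension prescribed on the basis. The identity for [a, S(x, y), c] is again obtained by integration, as
the derivative of the p-th power of the right multiplication by y along h is right multiplication by \<omega>\<^sub>y(h).
*)

theory Submission
  imports Defs
begin

section \<open>Triple products\<close>

locale triple_algebra = vector_space scale
  for scale :: "'k::field \<Rightarrow> 'v::ab_group_add \<Rightarrow> 'v" (infixr "*s" 75) +
  fixes br :: "'v \<Rightarrow> 'v \<Rightarrow> 'v \<Rightarrow> 'v"
  assumes br_add1: "br (x + x') y z = br x y z + br x' y z"
    and br_add2: "br x (y + y') z = br x y z + br x y' z"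
    and br_add3: "br x y (z + z') = br x y z + br x y z'"
    and br_scale1: "br (c *s x) y z = c *s br x y z"
    and br_scale2: "br x (c *s y) z = c *s br x y z"
    and br_scale3: "br x y (c *s z) = c *s br x y z"
begin

lemma br_zero [simp]: "br 0 y z = 0" "br x 0 z = 0" "br x y 0 = 0"
  using br_scale1[of 0 0 y z] br_scale2[of x 0 0 z] br_scale3[of x y 0 0] by simp_all

lemma br_minus [simp]: "br (- x) y z = - br x y z" "br x (- y) z = - br x y z"
    "br x y (- z) = - br x y z"
  using br_scale1[of "-1" x y z] br_scale2[of x "-1" y z] br_scale3[of x y "-1" z] by simp_all

lemma br_diff: "br (x - x') y z = br x y z - br x' y z" "br x (y - y') z = br x y z - br x y' z"
    "br x y (z - z') = br x y z - br x y z'"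
  using br_add1[of x "- x'" y z] br_add2[of x y "- y'" z] br_add3[of x y z "- z'"] by simp_all

lemmas br_linear = br_add1 br_add2 br_add3 br_scale1 br_scale2 br_scale3 br_diff

lemma br_sum1: "br (sum f A) y z = (\<Sum>i\<in>A. br (f i) y z)"
  by (induction A rule: infinite_finite_induct) (simp_all add: br_add1)

end

text \<open>In a Lie algebra this is x R_y^(2n), where R_y is right multiplication by y. Triple
  products absorb the factors in pairs, which suffices because p - 1 is even.\<close>

definition br_pow :: "('v \<Rightarrow> 'v \<Rightarrow> 'v \<Rightarrow> 'v) \<Rightarrow> 'v \<Rightarrow> nat \<Rightarrow> 'v \<Rightarrow> 'v"
  where "br_pow br y n x = ((\<lambda>z. br z y y) ^^ n) x"

lemma br_pow_simps [simp]: "br_pow br y 0 x = x" "br_pow br y (Suc n) x = br (br_pow br y n x) y y"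
  by (simp_all add: br_pow_def)

lemma br_pow_shift: "br_pow br y n (br x y y) = br_pow br y (Suc n) x"
  by (induction n) simp_all

lemma iter_br_replicate: "iter_br br (x # replicate (2 * n) y @ xs) = iter_br br (br_pow br y n x # xs)"
proof (induction n arbitrary: x)
  case (Suc n)
  have "iter_br br (x # replicate (2 * Suc n) y @ xs) = iter_br br (br x y y # replicate (2 * n) y @ xs)"
    by simp
  also have "\<dots> = iter_br br (br_pow br y (Suc n) x # xs)"
    by (simp only: Suc.IH br_pow_shift)
  finally show ?case .
qed simp

lemma iter_br_replicate_last:
  "iter_br br (x # replicate (Suc (2 * n)) y @ [z]) = br (br_pow br y n x) y z"
proof -
  have "replicate (Suc (2 * n)) y = replicate (2 * n) y @ [y]"
    by (simp add: replicate_append_same)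
  then show ?thesis
    using iter_br_replicate[of br x n y "[y, z]"] by simp
qed

text \<open>The derivative of \<open>y \<mapsto> br_pow br y n x\<close> in the direction \<open>k\<close>.\<close>

primrec br_pow_deriv ::
  "('v::monoid_add \<Rightarrow> 'v \<Rightarrow> 'v \<Rightarrow> 'v) \<Rightarrow> 'v \<Rightarrow> 'v \<Rightarrow> nat \<Rightarrow> 'v \<Rightarrow> 'v"
  where
    "br_pow_deriv br y k 0 x = 0"
  | "br_pow_deriv br y k (Suc n) x = br (br_pow_deriv br y k n x) y y
       + (br (br_pow br y n x) y k + br (br_pow br y n x) k y)"

context triple_algebra
begin

lemma br_pow_linear: "br_pow br y n (x + x') = br_pow br y n x + br_pow br y n x'"
    "br_pow br y n (c *s x) = c *s br_pow br y n x"
  by (induction n) (simp_all add: br_linear)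

lemma br_pow_zero [simp]: "br_pow br y n 0 = 0"
  by (induction n) simp_all

lemma br_pow_scale: "br_pow br (c *s y) n x = c ^ (2 * n) *s br_pow br y n x"
  by (induction n) (simp_all add: br_linear power2_eq_square mult.assoc)

lemma br_pow_deriv_linear:
  "br_pow_deriv br y (k + k') n x = br_pow_deriv br y k n x + br_pow_deriv br y k' n x"
  "br_pow_deriv br y (c *s k) n x = c *s br_pow_deriv br y k n x"
  by (induction n) (simp_all add: br_linear algebra_simps)

end

text \<open>Two instances matter later: formal differentiation of polynomials, and the
  coefficientwise action of a given derivation.\<close>

locale triple_derivation = triple_algebra scale br
  for scale :: "'k::field \<Rightarrow> 'v::ab_group_add \<Rightarrow> 'v" (infixr "*s" 75) and br +
  fixes d :: "'v \<Rightarrow> 'v"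
  assumes d_add: "d (x + y) = d x + d y" and d_scale: "d (c *s x) = c *s d x"
    and d_br: "d (br x y z) = br (d x) y z + br x (d y) z + br x y (d z)"
begin

lemma d_zero [simp]: "d 0 = 0"
  using d_scale[of 0 0] by simp

lemma d_minus [simp]: "d (- x) = - d x"
  using d_scale[of "-1" x] by simp

lemma d_diff: "d (x - y) = d x - d y"
  using d_add[of x "- y"] by simp

lemma d_br_pow: "d (br_pow br y n x) = br_pow br y n (d x) + br_pow_deriv br y (d y) n x"
  by (induction n) (simp_all add: d_br br_linear)

end

text \<open>Pascal's rule, for a sum to which one more factor R_y is applied; \<open>g 0\<close>
  supplies the missing coefficient \<open>n choose 0\<close>.\<close>

lemma (in vector_space) sum_binomial_step:
  fixes g :: "nat \<Rightarrow> 'b"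
  shows
  "(\<Sum>q<n. of_nat (n choose Suc q) *s (g q + g (Suc q))) + g 0
    = (\<Sum>q<Suc n. of_nat (Suc n choose Suc q) *s g q)"
proof -
  have 1: "(\<Sum>q<n. of_nat (n choose Suc q) *s g (Suc q)) + g 0 = (\<Sum>q<Suc n. of_nat (n choose q) *s g q)"
    by (subst sum.lessThan_Suc_shift) (simp add: add.commute)
  have 2: "(\<Sum>q<n. of_nat (n choose Suc q) *s g q) = (\<Sum>q<Suc n. of_nat (n choose Suc q) *s g q)"
    by (simp add: binomial_eq_0)
  have "(\<Sum>q<n. of_nat (n choose Suc q) *s (g q + g (Suc q))) + g 0
      = (\<Sum>q<n. of_nat (n choose Suc q) *s g q) + ((\<Sum>q<n. of_nat (n choose Suc q) *s g (Suc q)) + g 0)"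
    by (simp add: scale_right_distrib sum.distrib add.assoc)
  also have "\<dots> = (\<Sum>q<Suc n. of_nat (n choose Suc q) *s g q) + (\<Sum>q<Suc n. of_nat (n choose q) *s g q)"
    by (simp only: 1 2)
  also have "\<dots> = (\<Sum>q<Suc n. of_nat (Suc n choose Suc q) *s g q)"
    by (simp only: binomial_Suc_Suc of_nat_add scale_left_distrib sum.distrib add.commute)
  finally show ?thesis .
qed

section \<open>Modules over Lie triple systems\<close>

text \<open>\<open>V\<close> is a Lie triple system. Writing \<open>R\<^sub>x\<close> for right multiplication by \<open>x\<close> in a Lie algebra
  with \<open>br a b c = [[a, b], c]\<close>, the last two axioms say that
  \<open>R\<^bsub>br x y z\<^esub> = [[R\<^sub>x, R\<^sub>y], R\<^sub>z]\<close>, in the situations in which this can be expressed by triple products.\<close>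

locale lie_triple_module = triple_algebra scale br
  for scale :: "'k::field \<Rightarrow> 'v::ab_group_add \<Rightarrow> 'v" (infixr "*s" 75) and br +
  fixes V :: "'v set"
  assumes V_subspace: "subspace V"
    and V_br: "x \<in> V \<Longrightarrow> y \<in> V \<Longrightarrow> z \<in> V \<Longrightarrow> br x y z \<in> V"
    and skew: "x \<in> V \<Longrightarrow> y \<in> V \<Longrightarrow> z \<in> V \<Longrightarrow> br x y z = - br y x z"
    and cyclic: "x \<in> V \<Longrightarrow> y \<in> V \<Longrightarrow> z \<in> V \<Longrightarrow> br x y z + br y z x + br z x y = 0"
    and br_mid: "x \<in> V \<Longrightarrow> y \<in> V \<Longrightarrow> z \<in> V \<Longrightarrow>
      br a (br x y z) c = br (br a x y) z c - br (br a y x) z c - br (br a z x) y c + br (br a z y) x c"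
    and br_last: "w \<in> V \<Longrightarrow> x \<in> V \<Longrightarrow> y \<in> V \<Longrightarrow> z \<in> V \<Longrightarrow>
      br a w (br x y z) = br (br a w x) y z - br (br a w y) x z - br (br a w z) x y + br (br a w z) y x"
begin

lemma V_closed [simp]: "0 \<in> V" "x \<in> V \<Longrightarrow> y \<in> V \<Longrightarrow> x + y \<in> V" "x \<in> V \<Longrightarrow> c *s x \<in> V"
  using V_subspace by (auto simp: subspace_def)

lemma br_pow_in_V [simp]: "x \<in> V \<Longrightarrow> y \<in> V \<Longrightarrow> br_pow br y n x \<in> V"
  by (induction n) (simp_all add: V_br)

text \<open>For elements of a Lie algebra this is \<open>a R\<^sub>y\<^sup>l R\<^bsub>h'\<^esub>\<close> with \<open>h' = h R\<^sub>y\<^sup>q\<close>, for \<open>l + q\<close> odd.\<close>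

definition mixed :: "'v \<Rightarrow> 'v \<Rightarrow> 'v \<Rightarrow> nat \<Rightarrow> nat \<Rightarrow> 'v" where
  "mixed a y h l q =
    (if odd l then br (br_pow br y (l div 2) a) y (br_pow br y (q div 2) h)
     else br (br_pow br y (l div 2) a) (br_pow br y (q div 2) h) y
        - br (br_pow br y (l div 2) a) y (br_pow br y (q div 2) h))"

text \<open>In a Lie algebra R_h' R_y = R_y R_h' + R_[h',y], so each factor R_y raises either
  \<open>l\<close> or \<open>q\<close> by one. Two factors are applied at once because triple
  products express only the case of odd \<open>l + q\<close>.\<close>

lemma mixed_sq:
  assumes "y \<in> V" "h \<in> V" "odd (l + q)"
  shows "br (mixed a y h l q) y y
    = mixed a y h (l + 2) q + mixed a y h (l + 1) (q + 1)
      + (mixed a y h (l + 1) (q + 1) + mixed a y h l (q + 2))"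
proof -
  define A where "A = br_pow br y (l div 2) a"
  define H where "H = br_pow br y (q div 2) h"
  have H: "H \<in> V"
    using assms by (simp add: H_def)
  have last: "br A y (br H y y) = br (br A y H) y y - br (br A y y) H y
      - br (br A y y) H y + br (br A y y) y H"
    using assms H by (intro br_last) auto
  have mid: "br A (br H y y) y = br (br A H y) y y - br (br A y H) y y
      - br (br A y H) y y + br (br A y y) H y"
    using assms H by (intro br_mid) auto
  show ?thesis
  proof (cases "odd l")
    case True
    then have "even q"
      using assms by auto
    with True show ?thesis
      by (simp add: mixed_def last br_linear flip: A_def H_def)
  next
    case False
    then have "odd q"
      using assms by auto
    with False show ?thesis
      by (simp add: mixed_def last mid br_linear flip: A_def H_def)
  qed
qed

text \<open>By the product rule the derivative is the sum of the operators R_y^i R_h R_y^j with i +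
  j = 2m - 1. Moving R_h to the right past R_y^j gives the binomials j choose q, which add up to
  \<open>2 * m choose Suc q\<close>.\<close>

lemma br_pow_deriv_eq_sum:
  assumes "y \<in> V" "h \<in> V"
  shows "br_pow_deriv br y h m a
    = (\<Sum>q<2 * m. of_nat (2 * m choose Suc q) *s mixed a y h (2 * m - Suc q) q)"
proof (induction m)
  case (Suc m)
  define N where "N = 2 * m"
  then have M: "2 * Suc m = Suc (Suc N)"
    by simp
  define g where "g q = mixed a y h (Suc N - q) q" for q
  \<comment> \<open>\<open>g'\<close> is the stage with one of the two new factors R_y expanded, so
    Pascal's rule is used once with \<open>g'\<close> and once with \<open>g\<close>.\<close>
  define g' where "g' q = g q + g (Suc q)" for q
  have step: "br (mixed a y h (N - Suc q) q) y y = g' q + g' (Suc q)" if "q < N" for q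
  proof -
    have "odd (N - Suc q + q)"
      using that by (auto simp: N_def)
    then have "br (mixed a y h (N - Suc q) q) y y = mixed a y h (N - Suc q + 2) q
        + mixed a y h (N - Suc q + 1) (q + 1)
        + (mixed a y h (N - Suc q + 1) (q + 1) + mixed a y h (N - Suc q) (q + 2))"
      using assms by (intro mixed_sq) auto
    moreover have "N - Suc q + 2 = Suc N - q" "N - Suc q + 1 = Suc N - (q + 1)"
        "N - Suc q = Suc N - (q + 2)"
      using that by auto
    ultimately show ?thesis
      unfolding g'_def g_def by (simp only: Suc_eq_plus1 add.assoc) simp
  qed
  have new: "br (br_pow br y m a) y h + br (br_pow br y m a) h y = g' 0 + g 0"
    by (simp add: g'_def g_def mixed_def N_def)
  have "br_pow_deriv br y h (Suc m) a
      = (\<Sum>q<N. of_nat (N choose Suc q) *s br (mixed a y h (N - Suc q) q) y y) + (g' 0 + g 0)"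
    by (simp only: br_pow_deriv.simps Suc.IH new br_sum1 br_scale1 N_def)
  also have "\<dots> = (\<Sum>q<N. of_nat (N choose Suc q) *s (g' q + g' (Suc q))) + g' 0 + g 0"
    unfolding add.assoc by (intro arg_cong2[where f = plus] sum.cong refl) (simp only: step lessThan_iff)
  also have "\<dots> = (\<Sum>q<Suc (Suc N). of_nat (Suc (Suc N) choose Suc q) *s g q)"
    using sum_binomial_step[of N g'] sum_binomial_step[of "Suc N" g]
    by (simp only: g'_def)
  also have "\<dots> = (\<Sum>q<2 * Suc m. of_nat (2 * Suc m choose Suc q) *s mixed a y h (2 * Suc m - Suc q) q)"
    by (simp only: g_def M diff_Suc_Suc)
  finally show ?case .
qed simp

end

section \<open>Characteristic p: the closed one-form and the derivative of R_y^p\<close>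

locale lie_triple_module_char = lie_triple_module scale br V
  for scale :: "'k::field \<Rightarrow> 'v::ab_group_add \<Rightarrow> 'v" (infixr "*s" 75) and br V +
  fixes p m :: nat
  assumes char: "CHAR('k) = p" and p_odd: "p = Suc (2 * m)"
begin

lemma prime_p: "prime p"
  using prime_CHAR_semidom[where ?'a = 'k] char p_odd by simp

lemma m_pos: "m > 0"
  using prime_p p_odd by (cases m) auto

lemma of_nat_nonzero: "0 < i \<Longrightarrow> i < p \<Longrightarrow> of_nat i \<noteq> (0 :: 'k)"
  by (auto simp: of_nat_eq_0_iff_char_dvd char dest: dvd_imp_le)

text \<open>Since p divides \<open>p choose Suc k\<close>, Pascal's rule makes consecutive entries
  of row p - 1 opposite.\<close>

lemma binomial_mod_p: "k \<le> 2 * m \<Longrightarrow> of_nat (2 * m choose k) = ((- 1) ^ k :: 'k)"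
proof (induction k)
  case (Suc k)
  have "p dvd (p choose Suc k)"
    using Suc.prems prime_p p_odd by (intro dvd_choose_prime) auto
  then have "of_nat (p choose Suc k) = (0 :: 'k)"
    by (simp add: of_nat_eq_0_iff_char_dvd char)
  then have "of_nat (2 * m choose k) + of_nat (2 * m choose Suc k) = (0 :: 'k)"
    by (simp add: p_odd)
  with Suc show ?case
    by (simp add: add_eq_0_iff)
qed simp

lemma br_pow_deriv_eq_alt_sum:
  assumes "y \<in> V" "h \<in> V"
  shows "br_pow_deriv br y h m a = (\<Sum>q<2 * m. (- 1) ^ Suc q *s mixed a y h (2 * m - Suc q) q)"
  unfolding br_pow_deriv_eq_sum[OF assms] by (intro sum.cong refl) (simp only: binomial_mod_p lessThan_iff Suc_le_eq)

text \<open>In a Lie algebra \<open>mixed a y h l q\<close> is the bracket of a R_y^l with h R_y^q,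
  which is antisymmetric. In terms of triple products this follows from \<open>cyclic\<close> and
  \<open>skew\<close>.\<close>

lemma mixed_swap:
  assumes "a \<in> V" "y \<in> V" "h \<in> V" "odd (l + q)"
  shows "mixed a y h l q = - mixed h y a q l"
proof -
  define A where "A = br_pow br y (l div 2) a"
  define H where "H = br_pow br y (q div 2) h"
  have AH: "A \<in> V" "H \<in> V"
    using assms by (simp_all add: A_def H_def)
  have 1: "br A y H = br H y A - br H A y"
    using cyclic[of A y H] skew[of y H A] assms AH unfolding eq_iff_diff_eq_0[of "br A y H"]
    by (simp add: algebra_simps)
  have 2: "br H y A = br A y H - br A H y"
    using cyclic[of H y A] skew[of y A H] assms AH unfolding eq_iff_diff_eq_0[of "br H y A"]
    by (simp add: algebra_simps)
  show ?thesis
  proof (cases "odd l")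
    case True
    then have "even q"
      using assms by auto
    with True 1 show ?thesis
      by (simp add: mixed_def flip: A_def H_def)
  next
    case False
    then have "odd q"
      using assms by auto
    with False 2 show ?thesis
      by (simp add: mixed_def flip: A_def H_def)
  qed
qed

text \<open>The one-form \<open>h \<mapsto> br_pow br y m h\<close> at the point \<open>y\<close> is closed.\<close>

lemma br_pow_deriv_commute:
  assumes "y \<in> V" "h \<in> V" "k \<in> V"
  shows "br_pow_deriv br y k m h = br_pow_deriv br y h m k"
proof -
  have "br_pow_deriv br y k m h = (\<Sum>q<2 * m. (- 1) ^ Suc q *s mixed h y k (2 * m - Suc q) q)"
    using assms by (simp only: br_pow_deriv_eq_alt_sum)
  \<comment> \<open>Reversing the sum interchanges the two exponents, whose total 2m - 1 is odd; the
    resulting change of sign cancels the one in \<open>mixed_swap\<close>.\<close>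
  also have "\<dots> = (\<Sum>q<2 * m. (- 1) ^ Suc (2 * m - Suc q) *s mixed h y k (2 * m - Suc (2 * m - Suc q)) (2 * m - Suc q))"
    by (rule sum.nat_diff_reindex[symmetric])
  also have "\<dots> = (\<Sum>q<2 * m. (- 1) ^ Suc q *s mixed k y h (2 * m - Suc q) q)"
  proof (intro sum.cong refl)
    fix q assume "q \<in> {..<2 * m}"
    then have q: "q < 2 * m"
      by simp
    then have e: "2 * m - Suc (2 * m - Suc q) = q" "odd (q + (2 * m - Suc q))"
      by auto
    have "(- 1 :: 'k) ^ Suc (2 * m - Suc q) = (- 1) ^ q"
    proof (cases "even q")
      case True
      then have "even (Suc (2 * m - Suc q))" using q by auto
      with True show ?thesis by (metis power_minus_even power_one)
    next
      case False
      then have "odd (Suc (2 * m - Suc q))" using q by auto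
      with False show ?thesis by (metis power_minus_odd power_one)
    qed
    then show "(- 1) ^ Suc (2 * m - Suc q) *s mixed h y k (2 * m - Suc (2 * m - Suc q)) (2 * m - Suc q)
        = (- 1) ^ Suc q *s mixed k y h (2 * m - Suc q) q"
      using mixed_swap[OF assms(2,1,3) e(2)] by (simp only: e) simp
  qed
  also have "\<dots> = br_pow_deriv br y h m k"
    using assms by (simp only: br_pow_deriv_eq_alt_sum)
  finally show ?thesis .
qed

text \<open>The derivative of \<open>R\<^sub>y\<^sup>p\<close> in the direction \<open>h\<close> is right multiplication by \<open>br_pow br y m h\<close>.\<close>

lemma br_pow_deriv_operator:
  assumes "y \<in> V" "h \<in> V"
  shows "br (br_pow_deriv br y h m a) y c + br (br_pow br y m a) h c = br a (br_pow br y m h) c"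
proof -
  \<comment> \<open>For even \<open>l + q\<close> this is a R_y^l followed by right multiplications
    by h R_y^q and by c. Moving a factor R_y to the left produces two neighbours, and with
    alternating signs the sum telescopes.\<close>
  define B where "B l q = (if odd l
      then br (br (br_pow br y (l div 2) a) y (br_pow br y (q div 2) h)) y c
        - br (br (br_pow br y (l div 2) a) y y) (br_pow br y (q div 2) h) c
      else br (br_pow br y (l div 2) a) (br_pow br y (q div 2) h) c)" for l q
  have step: "br (mixed a y h l q) y c = B (Suc l) q + B l (Suc q)" if "odd (l + q)" for l q
  proof -
    define A where "A = br_pow br y (l div 2) a"
    define H where "H = br_pow br y (q div 2) h"
    have H: "H \<in> V"
      using assms by (simp add: H_def)
    have mid: "br A (br H y y) c = br (br A H y) y c - br (br A y H) y c
        - br (br A y H) y c + br (br A y y) H c"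
      using assms H by (intro br_mid) auto
    show ?thesis
    proof (cases "odd l")
      case True
      then have "even q"
        using that by auto
      with True show ?thesis
        by (simp add: mixed_def B_def br_linear flip: A_def H_def)
    next
      case False
      then have "odd q"
        using that by auto
      with False show ?thesis
        by (simp add: mixed_def B_def mid br_linear flip: A_def H_def)
    qed
  qed
  define f where "f q = (- 1) ^ q *s B (2 * m - q) q" for q
  have "br (br_pow_deriv br y h m a) y c
      = (\<Sum>q<2 * m. (- 1) ^ Suc q *s br (mixed a y h (2 * m - Suc q) q) y c)"
    using assms by (simp only: br_pow_deriv_eq_alt_sum br_sum1 br_scale1)
  also have "\<dots> = (\<Sum>q<2 * m. f (Suc q) - f q)"
  proof (intro sum.cong refl)
    fix q assume "q \<in> {..<2 * m}"
    then have q: "Suc (2 * m - Suc q) = 2 * m - q" "odd (2 * m - Suc q + q)"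
      by auto
    show "(- 1) ^ Suc q *s br (mixed a y h (2 * m - Suc q) q) y c = f (Suc q) - f q"
      unfolding step[OF q(2)] q(1) f_def by (simp add: scale_right_distrib)
  qed
  also have "\<dots> = f (2 * m) - f 0"
    by (rule sum_lessThan_telescope)
  also have "\<dots> = br a (br_pow br y m h) c - br (br_pow br y m a) h c"
    by (simp add: f_def B_def)
  finally show ?thesis
    by simp
qed

end

section \<open>Polynomial extension\<close>

definition scale_poly :: "('k \<Rightarrow> 'v::zero \<Rightarrow> 'v) \<Rightarrow> 'k \<Rightarrow> 'v poly \<Rightarrow> 'v poly"
  where "scale_poly scale c P = map_poly (scale c) P"

definition polys :: "'v::zero set \<Rightarrow> 'v poly set"
  where "polys V = {P. \<forall>n. coeff P n \<in> V}"

definition poly_deriv :: "('k::semiring_1 \<Rightarrow> 'v::zero \<Rightarrow> 'v) \<Rightarrow> 'v poly \<Rightarrow> 'v poly"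
  where "poly_deriv scale P = Abs_poly (\<lambda>n. scale (of_nat (Suc n)) (coeff P (Suc n)))"

definition poly_eval :: "('k::semiring_1 \<Rightarrow> 'v::comm_monoid_add \<Rightarrow> 'v) \<Rightarrow> 'k \<Rightarrow> 'v poly \<Rightarrow> 'v"
  where "poly_eval scale e P = (\<Sum>i\<le>degree P. scale (e ^ i) (coeff P i))"

lemma polys_UNIV [simp]: "polys UNIV = UNIV"
  by (simp add: polys_def)

lemma pCons_in_polys [simp]: "0 \<in> V \<Longrightarrow> pCons a P \<in> polys V \<longleftrightarrow> a \<in> V \<and> P \<in> polys V"
  by (auto simp: polys_def coeff_pCons split: nat.splits)

lemma zero_in_polys [simp]: "0 \<in> V \<Longrightarrow> 0 \<in> polys V"
  by (simp add: polys_def)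

section \<open>Induction over monomials and vanishing of multiadditive maps\<close>

lemma poly_monom_induct:
  assumes "\<And>n. coeff P n \<in> A n"
    and "\<And>n c. c \<in> A n \<Longrightarrow> Q (monom c n)"
    and "Q 0" and "\<And>P R. Q P \<Longrightarrow> Q R \<Longrightarrow> Q (P + R)"
  shows "Q P"
proof -
  have "Q (\<Sum>i\<in>I. monom (coeff P i) i)" for I
    by (induction I rule: infinite_finite_induct) (use assms in auto)
  from this[of "{..degree P}"] show ?thesis
    by (simp add: poly_as_sum_of_monoms)
qed

text \<open>Sums without scalars: identities that are additive in each argument pass from monomials
  or homogeneous elements to all elements, without any linearity over the field.\<close>

inductive_set add_closure :: "'v::monoid_add set \<Rightarrow> 'v set" for G where
  zero: "0 \<in> add_closure G"
| base: "x \<in> G \<Longrightarrow> x \<in> add_closure G"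
| add: "x \<in> add_closure G \<Longrightarrow> y \<in> add_closure G \<Longrightarrow> x + y \<in> add_closure G"

lemma additive_vanish:
  fixes F :: "'v::monoid_add \<Rightarrow> 'w::ab_group_add"
  assumes "x \<in> add_closure G" "\<And>x y. F (x + y) = F x + F y" "\<And>x. x \<in> G \<Longrightarrow> F x = 0"
  shows "F x = 0"
  using assms(1)
proof induction
  case zero
  show ?case
    using assms(2)[of 0 0] by simp
qed (use assms in auto)

lemma additive_vanish3:
  fixes F :: "'v::monoid_add \<Rightarrow> 'v \<Rightarrow> 'v \<Rightarrow> 'w::ab_group_add"
  assumes "x \<in> add_closure A" "y \<in> add_closure B" "z \<in> add_closure C"
    and "\<And>x x' y z. F (x + x') y z = F x y z + F x' y z"
    and "\<And>x y y' z. F x (y + y') z = F x y z + F x y' z"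
    and "\<And>x y z z'. F x y (z + z') = F x y z + F x y z'"
    and "\<And>x y z. x \<in> A \<Longrightarrow> y \<in> B \<Longrightarrow> z \<in> C \<Longrightarrow> F x y z = 0"
  shows "F x y z = 0"
proof -
  have "F x y z = 0" if "y \<in> B" "z \<in> C" for y z
    by (rule additive_vanish[OF assms(1)]) (use assms(4,7) that in auto)
  then have "F x y z = 0" if "z \<in> C" for z
    using assms(5) that by (intro additive_vanish[OF assms(2), where F = "\<lambda>y. F x y z"]) auto
  then show ?thesis
    using assms(6) by (intro additive_vanish[OF assms(3), where F = "F x y"]) auto
qed

lemma additive_vanish5:
  fixes F :: "'v::monoid_add \<Rightarrow> 'v \<Rightarrow> 'v \<Rightarrow> 'v \<Rightarrow> 'v \<Rightarrow> 'w::ab_group_add"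
  assumes "x \<in> add_closure A" "y \<in> add_closure B" "z \<in> add_closure C" "s \<in> add_closure D"
      "t \<in> add_closure E"
    and "\<And>x x' y z s t. F (x + x') y z s t = F x y z s t + F x' y z s t"
    and "\<And>x y y' z s t. F x (y + y') z s t = F x y z s t + F x y' z s t"
    and "\<And>x y z z' s t. F x y (z + z') s t = F x y z s t + F x y z' s t"
    and "\<And>x y z s s' t. F x y z (s + s') t = F x y z s t + F x y z s' t"
    and "\<And>x y z s t t'. F x y z s (t + t') = F x y z s t + F x y z s t'"
    and "\<And>x y z s t. x \<in> A \<Longrightarrow> y \<in> B \<Longrightarrow> z \<in> C \<Longrightarrow> s \<in> D \<Longrightarrow> t \<in> E \<Longrightarrow> F x y z s t = 0"
  shows "F x y z s t = 0"
proof -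
  have "F x y z s t = 0" if "s \<in> D" "t \<in> E" for s t
    by (rule additive_vanish3[OF assms(1-3), where F = "\<lambda>x y z. F x y z s t"])
      (use assms(6-8,11) that in auto)
  then have "F x y z s t = 0" if "t \<in> E" for t
    using assms(9) that by (intro additive_vanish[OF assms(4), where F = "\<lambda>s. F x y z s t"]) auto
  then show ?thesis
    using assms(10) by (intro additive_vanish[OF assms(5), where F = "F x y z s"]) auto
qed

lemma polys_add_closure: "P \<in> polys V \<Longrightarrow> P \<in> add_closure {monom c n |c n. c \<in> V}"
  by (rule poly_monom_induct[where A = "\<lambda>_. V"]) (auto simp: polys_def intro: add_closure.intros)

lemma poly_vanish:
  fixes F :: "'v::comm_monoid_add poly \<Rightarrow> 'w::ab_group_add"
  assumes "P \<in> polys V" "\<And>x y. F (x + y) = F x + F y" "\<And>c n. c \<in> V \<Longrightarrow> F (monom c n) = 0"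
  shows "F P = 0"
  by (rule additive_vanish[OF polys_add_closure[OF assms(1)]]) (use assms(2-) in auto)

lemma poly_vanish3:
  fixes F :: "'v::comm_monoid_add poly \<Rightarrow> 'v poly \<Rightarrow> 'v poly \<Rightarrow> 'w::ab_group_add"
  assumes "P \<in> polys A" "Q \<in> polys B" "R \<in> polys C"
    and "\<And>x x' y z. F (x + x') y z = F x y z + F x' y z"
    and "\<And>x y y' z. F x (y + y') z = F x y z + F x y' z"
    and "\<And>x y z z'. F x y (z + z') = F x y z + F x y z'"
    and "\<And>a b c i j k. a \<in> A \<Longrightarrow> b \<in> B \<Longrightarrow> c \<in> C \<Longrightarrow> F (monom a i) (monom b j) (monom c k) = 0"
  shows "F P Q R = 0"
  by (rule additive_vanish3[OF assms(1-3)[THEN polys_add_closure]]) (use assms(4-) in auto)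

lemma poly_vanish5:
  fixes F :: "'v::comm_monoid_add poly \<Rightarrow> 'v poly \<Rightarrow> 'v poly \<Rightarrow> 'v poly \<Rightarrow> 'v poly \<Rightarrow> 'w::ab_group_add"
  assumes "P \<in> polys A" "Q \<in> polys B" "R \<in> polys C" "S \<in> polys D" "U \<in> polys E"
    and "\<And>x x' y z s u. F (x + x') y z s u = F x y z s u + F x' y z s u"
    and "\<And>x y y' z s u. F x (y + y') z s u = F x y z s u + F x y' z s u"
    and "\<And>x y z z' s u. F x y (z + z') s u = F x y z s u + F x y z' s u"
    and "\<And>x y z s s' u. F x y z (s + s') u = F x y z s u + F x y z s' u"
    and "\<And>x y z s u u'. F x y z s (u + u') = F x y z s u + F x y z s u'"
    and "\<And>a b c s u i j k l n. a \<in> A \<Longrightarrow> b \<in> B \<Longrightarrow> c \<in> C \<Longrightarrow> s \<in> D \<Longrightarrow> u \<in> E \<Longrightarrow>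
      F (monom a i) (monom b j) (monom c k) (monom s l) (monom u n) = 0"
  shows "F P Q R S U = 0"
  by (rule additive_vanish5[OF assms(1-5)[THEN polys_add_closure]]) (use assms(6-) in auto)

section \<open>Scalars, derivative and evaluation for polynomials over a vector space\<close>

context vector_space
begin

lemma coeff_scale_poly [simp]: "coeff (scale_poly scale c P) n = c *s coeff P n"
  by (simp add: scale_poly_def coeff_map_poly)

lemma vector_space_scale_poly: "vector_space (scale_poly scale)"
  by unfold_locales (auto intro!: poly_eqI simp: scale_right_distrib scale_left_distrib)

lemma scale_poly_monom [simp]: "scale_poly scale c (monom a n) = monom (c *s a) n"
  by (intro poly_eqI) simp

lemma scale_poly_pCons [simp]: "scale_poly scale c (pCons a P) = pCons (c *s a) (scale_poly scale c P)"
  by (intro poly_eqI) (simp add: coeff_pCons split: nat.splits)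

lemma scale_poly_0 [simp]: "scale_poly scale c 0 = 0"
  by (simp add: scale_poly_def)

lemma coeff_poly_deriv [simp]: "coeff (poly_deriv scale P) n = of_nat (Suc n) *s coeff P (Suc n)"
  unfolding poly_deriv_def
  by (subst coeff_Abs_poly[where n = "degree P"]) (auto simp: coeff_eq_0)

lemma poly_deriv_monom: "poly_deriv scale (monom a n) = monom (of_nat n *s a) (n - 1)"
  by (cases n) (intro poly_eqI; auto)+

lemma poly_eval_bound:
  assumes "degree P \<le> N"
  shows "poly_eval scale e P = (\<Sum>i\<le>N. e ^ i *s coeff P i)"
  unfolding poly_eval_def using assms by (intro sum.mono_neutral_left) (auto simp: coeff_eq_0)

lemma poly_eval_add: "poly_eval scale e (P + Q) = poly_eval scale e P + poly_eval scale e Q"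
proof -
  define N where "N = max (degree P) (degree Q)"
  have "degree (P + Q) \<le> N"
    by (simp add: N_def degree_add_le_max)
  then show ?thesis
    by (simp add: poly_eval_bound[of _ N] N_def scale_right_distrib sum.distrib)
qed

lemma poly_eval_scale: "poly_eval scale e (scale_poly scale c P) = c *s poly_eval scale e P"
proof -
  have "degree (scale_poly scale c P) \<le> degree P"
    by (intro degree_le) (simp add: coeff_eq_0)
  then show ?thesis
    by (simp add: poly_eval_bound[of _ "degree P"] scale_sum_right mult.commute)
qed

lemma poly_eval_monom: "poly_eval scale e (monom a n) = e ^ n *s a"
proof -
  have "poly_eval scale e (monom a n) = (\<Sum>i\<le>n. if i = n then e ^ n *s a else 0)"
    unfolding poly_eval_bound[OF degree_monom_le] by (intro sum.cong) auto
  then show ?thesis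
    by simp
qed

lemma poly_eval_pCons [simp]: "poly_eval scale e (pCons a P) = a + e *s poly_eval scale e P"
proof -
  have "poly_eval scale e (pCons a P) = (\<Sum>i\<le>Suc (degree P). e ^ i *s coeff (pCons a P) i)"
    by (intro poly_eval_bound) (simp add: degree_pCons_le)
  also have "\<dots> = a + e *s poly_eval scale e P"
    by (subst sum.atMost_Suc_shift) (simp add: poly_eval_def scale_sum_right)
  finally show ?thesis .
qed

lemma poly_eval_0 [simp]: "poly_eval scale e 0 = 0"
  by (simp add: poly_eval_def)

lemma poly_eval_at_0: "poly_eval scale 0 P = coeff P 0"
  by (cases P) simp

end

lemma map_poly_add: "f 0 = 0 \<Longrightarrow> (\<And>x y. f (x + y) = f x + f y) \<Longrightarrow> map_poly f (P + Q) = map_poly f P + map_poly f Q"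
  by (intro poly_eqI) (simp add: coeff_map_poly)

lemma br_pow_hom:
  assumes "\<And>x y z. f (br x y z) = br' (f x) (f y) (f z)"
  shows "f (br_pow br y n x) = br_pow br' (f y) n (f x)"
  by (induction n) (simp_all add: assms)

text \<open>The sets may depend on the exponent: constant families give closure and grading
  statements, varying ones bound the degree in a second variable.\<close>

lemma coeff_poly_br_in:
  assumes br: "\<And>a b c i j k. a \<in> A i \<Longrightarrow> b \<in> B j \<Longrightarrow> c \<in> C k \<Longrightarrow> br a b c \<in> D (i + j + k)"
    and D: "\<And>n. 0 \<in> D n" "\<And>n x y. x \<in> D n \<Longrightarrow> y \<in> D n \<Longrightarrow> x + y \<in> D n"
    and "\<And>n. coeff P n \<in> A n" "\<And>n. coeff Q n \<in> B n" "\<And>n. coeff R n \<in> C n"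
  shows "coeff (poly_br br P Q R) n \<in> D n"
proof -
  have sum: "sum f I \<in> D n" if "\<And>i. i \<in> I \<Longrightarrow> f i \<in> D n" for f :: "nat \<Rightarrow> _" and I
    using that by (induction I rule: infinite_finite_induct) (auto intro: D)
  show ?thesis
    unfolding poly_br_def coeff_sum using assms by (intro sum) (auto intro: D)
qed

section \<open>The triple product on polynomials\<close>

context triple_algebra
begin

lemma poly_br_bound:
  assumes "degree P \<le> A" "degree Q \<le> B" "degree R \<le> C"
  shows "poly_br br P Q R = (\<Sum>i\<le>A. \<Sum>j\<le>B. \<Sum>k\<le>C. monom (br (coeff P i) (coeff Q j) (coeff R k)) (i + j + k))"
proof -
  have 1: "(\<Sum>k\<le>degree R. monom (br (coeff P i) (coeff Q j) (coeff R k)) (i + j + k))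
      = (\<Sum>k\<le>C. monom (br (coeff P i) (coeff Q j) (coeff R k)) (i + j + k))" for i j
    using assms by (intro sum.mono_neutral_left) (auto simp: coeff_eq_0)
  have 2: "(\<Sum>j\<le>degree Q. \<Sum>k\<le>C. monom (br (coeff P i) (coeff Q j) (coeff R k)) (i + j + k))
      = (\<Sum>j\<le>B. \<Sum>k\<le>C. monom (br (coeff P i) (coeff Q j) (coeff R k)) (i + j + k))" for i
    using assms by (intro sum.mono_neutral_left) (auto simp: coeff_eq_0)
  show ?thesis
    unfolding poly_br_def 1 2 using assms by (intro sum.mono_neutral_left) (auto simp: coeff_eq_0)
qed

lemma poly_br_monom: "poly_br br (monom a i) (monom b j) (monom c k) = monom (br a b c) (i + j + k)"
proof -
  have "poly_br br (monom a i) (monom b j) (monom c k) = (\<Sum>i'\<le>i. \<Sum>j'\<le>j. \<Sum>k'\<le>k.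
      if k' = k then (if j' = j then (if i' = i then monom (br a b c) (i + j + k) else 0) else 0) else 0)"
    unfolding poly_br_bound[OF degree_monom_le degree_monom_le degree_monom_le]
    by (intro sum.cong) auto
  then show ?thesis
    by simp
qed

lemma degree_poly_br_le:
  assumes "degree P \<le> A" "degree Q \<le> B" "degree R \<le> C"
  shows "degree (poly_br br P Q R) \<le> A + B + C"
  unfolding poly_br_bound[OF assms]
  by (intro degree_sum_le) (auto intro!: order.trans[OF degree_monom_le])

lemma coeff_poly_br_top:
  assumes "degree P \<le> A" "degree Q \<le> B" "degree R \<le> C"
  shows "coeff (poly_br br P Q R) (A + B + C) = br (coeff P A) (coeff Q B) (coeff R C)"
proof -
  have "coeff (poly_br br P Q R) (A + B + C) = (\<Sum>i\<le>A. \<Sum>j\<le>B. \<Sum>k\<le>C.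
      if k = C then (if j = B then (if i = A then br (coeff P A) (coeff Q B) (coeff R C) else 0) else 0) else 0)"
    unfolding poly_br_bound[OF assms] coeff_sum by (intro sum.cong) auto
  then show ?thesis
    by simp
qed

lemma poly_br_add:
  "poly_br br (P + P') Q R = poly_br br P Q R + poly_br br P' Q R"
  "poly_br br P (Q + Q') R = poly_br br P Q R + poly_br br P Q' R"
  "poly_br br P Q (R + R') = poly_br br P Q R + poly_br br P Q R'"
proof -
  define N where "N = Max {degree P, degree P', degree Q, degree Q', degree R, degree R'}"
  have deg: "degree P \<le> N" "degree P' \<le> N" "degree Q \<le> N" "degree Q' \<le> N" "degree R \<le> N" "degree R' \<le> N"
    by (simp_all add: N_def)
  then have "degree (P + P') \<le> N" "degree (Q + Q') \<le> N" "degree (R + R') \<le> N"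
    by (auto intro: degree_add_le)
  note * = this deg
  show "poly_br br (P + P') Q R = poly_br br P Q R + poly_br br P' Q R"
    "poly_br br P (Q + Q') R = poly_br br P Q R + poly_br br P Q' R"
    "poly_br br P Q (R + R') = poly_br br P Q R + poly_br br P Q R'"
    using * by (simp_all add: poly_br_bound[of _ N _ N _ N] br_linear sum.distrib flip: add_monom)
qed

lemma poly_br_scale:
  "poly_br br (scale_poly scale c P) Q R = scale_poly scale c (poly_br br P Q R)"
  "poly_br br P (scale_poly scale c Q) R = scale_poly scale c (poly_br br P Q R)"
  "poly_br br P Q (scale_poly scale c R) = scale_poly scale c (poly_br br P Q R)"
proof -
  interpret P: vector_space "scale_poly scale" by (rule vector_space_scale_poly)
  have deg: "degree (scale_poly scale c P) \<le> degree P" for P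
    by (intro degree_le) (simp add: coeff_eq_0)
  show "poly_br br (scale_poly scale c P) Q R = scale_poly scale c (poly_br br P Q R)"
    "poly_br br P (scale_poly scale c Q) R = scale_poly scale c (poly_br br P Q R)"
    "poly_br br P Q (scale_poly scale c R) = scale_poly scale c (poly_br br P Q R)"
    using deg by (simp_all add: poly_br_bound[of _ "degree P" _ "degree Q" _ "degree R"] br_linear
        P.scale_sum_right)
qed

lemma triple_algebra_poly: "triple_algebra (scale_poly scale) (poly_br br)"
  by (intro triple_algebra.intro vector_space_scale_poly triple_algebra_axioms.intro)
    (simp_all add: poly_br_add poly_br_scale)

lemma poly_eval_br: "poly_eval scale e (poly_br br P Q R)
    = br (poly_eval scale e P) (poly_eval scale e Q) (poly_eval scale e R)"
proof -
  let ?F = "\<lambda>P Q R. poly_eval scale e (poly_br br P Q R)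
    - br (poly_eval scale e P) (poly_eval scale e Q) (poly_eval scale e R)"
  have "?F P Q R = 0"
    by (rule poly_vanish3[of P UNIV Q UNIV R UNIV ?F])
      (simp_all add: poly_br_add poly_eval_add br_linear poly_br_monom poly_eval_monom power_add mult_ac)
  then show ?thesis
    by simp
qed

lemma poly_br_const: "poly_br br [:a:] Q [:c:] = map_poly (\<lambda>b. br a b c) Q"
proof -
  let ?F = "\<lambda>Q. poly_br br [:a:] Q [:c:] - map_poly (\<lambda>b. br a b c) Q"
  have "?F Q = 0"
    by (rule poly_vanish[of Q UNIV ?F])
      (simp_all add: poly_br_add map_poly_add br_linear map_poly_monom poly_br_monom flip: monom_0)
  then show ?thesis
    by simp
qed

lemma poly_br_shift:
  "poly_br br (pCons 0 P) Q R = pCons 0 (poly_br br P Q R)"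
  "poly_br br P (pCons 0 Q) R = pCons 0 (poly_br br P Q R)"
  "poly_br br P Q (pCons 0 R) = pCons 0 (poly_br br P Q R)"
proof -
  have 0: "pCons 0 (x + y) = pCons 0 x + pCons 0 y" for x y :: "'v poly"
    by simp
  have "poly_br br (pCons 0 P) Q R - pCons 0 (poly_br br P Q R) = 0"
    by (rule poly_vanish3[of P UNIV Q UNIV R UNIV "\<lambda>P Q R. poly_br br (pCons 0 P) Q R - pCons 0 (poly_br br P Q R)"])
      (simp_all only: 0 poly_br_add poly_br_monom algebra_simps flip: monom_Suc, simp_all add: add_ac)
  moreover have "poly_br br P (pCons 0 Q) R - pCons 0 (poly_br br P Q R) = 0"
    by (rule poly_vanish3[of P UNIV Q UNIV R UNIV "\<lambda>P Q R. poly_br br P (pCons 0 Q) R - pCons 0 (poly_br br P Q R)"])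
      (simp_all only: 0 poly_br_add poly_br_monom algebra_simps flip: monom_Suc, simp_all add: add_ac)
  moreover have "poly_br br P Q (pCons 0 R) - pCons 0 (poly_br br P Q R) = 0"
    by (rule poly_vanish3[of P UNIV Q UNIV R UNIV "\<lambda>P Q R. poly_br br P Q (pCons 0 R) - pCons 0 (poly_br br P Q R)"])
      (simp_all only: 0 poly_br_add poly_br_monom algebra_simps flip: monom_Suc, simp_all add: add_ac)
  ultimately show
    "poly_br br (pCons 0 P) Q R = pCons 0 (poly_br br P Q R)"
    "poly_br br P (pCons 0 Q) R = pCons 0 (poly_br br P Q R)"
    "poly_br br P Q (pCons 0 R) = pCons 0 (poly_br br P Q R)"
    by simp_all
qed

lemma triple_derivation_poly_deriv:
  "triple_derivation (scale_poly scale) (poly_br br) (poly_deriv scale)"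
proof -
  interpret P: triple_algebra "scale_poly scale" "poly_br br" by (rule triple_algebra_poly)
  let ?d = "poly_deriv scale"
  have add: "?d (P + Q) = ?d P + ?d Q" for P Q
    by (intro poly_eqI) (simp add: scale_right_distrib)
  let ?F = "\<lambda>P Q R. ?d (poly_br br P Q R)
    - (poly_br br (?d P) Q R + poly_br br P (?d Q) R + poly_br br P Q (?d R))"
  have mon: "?F (monom a i) (monom b j) (monom c k) = 0" for a b c i j k
  proof -
    \<comment> \<open>At exponent 0 truncated subtraction makes the exponents differ, but then the
      coefficient is 0.\<close>
    have "monom (of_nat i *s br a b c) (i - Suc 0 + j + k) = monom (of_nat i *s br a b c) (i + j + k - Suc 0)"
      "monom (of_nat j *s br a b c) (i + (j - Suc 0) + k) = monom (of_nat j *s br a b c) (i + j + k - Suc 0)"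
      "monom (of_nat k *s br a b c) (i + j + (k - Suc 0)) = monom (of_nat k *s br a b c) (i + j + k - Suc 0)"
      by (cases i, simp, simp) (cases j, simp, simp, cases k, simp, simp)
    then show ?thesis
      by (simp add: poly_br_monom poly_deriv_monom br_linear add_monom flip: scale_left_distrib)
  qed
  have "?F P Q R = 0" for P Q R
    by (rule poly_vanish3[of P UNIV Q UNIV R UNIV ?F])
      (rule mon | simp only: polys_UNIV UNIV_I | simp only: add P.br_linear algebra_simps)+
  then show ?thesis
    by unfold_locales (auto simp: add intro!: poly_eqI mult.commute)
qed

lemma map_poly_br:
  assumes "f 0 = 0" "\<And>x y. f (x + y) = f x + f y"
    and "triple_algebra scale' br'" "\<And>x y z. f (br x y z) = br' (f x) (f y) (f z)"
  shows "map_poly f (poly_br br P Q R) = poly_br br' (map_poly f P) (map_poly f Q) (map_poly f R)"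
proof -
  interpret T': triple_algebra scale' br' by fact
  let ?F = "\<lambda>P Q R. map_poly f (poly_br br P Q R) - poly_br br' (map_poly f P) (map_poly f Q) (map_poly f R)"
  have "?F P Q R = 0"
    by (rule poly_vanish3[of P UNIV Q UNIV R UNIV ?F])
      (simp_all add: map_poly_add assms poly_br_add T'.poly_br_add poly_br_monom T'.poly_br_monom map_poly_monom)
  then show ?thesis
    by simp
qed

end

text \<open>This lets a derivation of the coefficients act under the integral sign, with the
  integration variable as a constant.\<close>

lemma (in triple_derivation) triple_derivation_map_poly:
  "triple_derivation (scale_poly scale) (poly_br br) (map_poly d)"
proof -
  interpret P: triple_algebra "scale_poly scale" "poly_br br" by (rule triple_algebra_poly)
  let ?d = "map_poly d"
  have add: "?d (P + Q) = ?d P + ?d Q" for P Q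
    by (intro map_poly_add d_zero d_add)
  let ?F = "\<lambda>P Q R. ?d (poly_br br P Q R)
    - (poly_br br (?d P) Q R + poly_br br P (?d Q) R + poly_br br P Q (?d R))"
  have mon: "?F (monom a i) (monom b j) (monom c k) = 0" for a b c i j k
    by (simp add: poly_br_monom map_poly_monom d_br add_monom)
  have "?F P Q R = 0" for P Q R
    by (rule poly_vanish3[of P UNIV Q UNIV R UNIV ?F])
      (rule mon | simp only: polys_UNIV UNIV_I | simp only: add P.br_linear algebra_simps)+
  then show ?thesis
    by unfold_locales (auto simp: add coeff_map_poly d_scale intro!: poly_eqI)
qed

text \<open>All axioms are additive in each argument, so they reduce to monomials. What is shown for
  modules then also holds at polynomial points such as Zx + y.\<close>

lemma (in lie_triple_module) lie_triple_module_poly: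
  "lie_triple_module (scale_poly scale) (poly_br br) (polys V)"
proof -
  interpret P: triple_algebra "scale_poly scale" "poly_br br" by (rule triple_algebra_poly)
  show ?thesis
  proof
    show "P.subspace (polys V)"
      by (auto simp: P.subspace_def polys_def)
    show "poly_br br x y z \<in> polys V" if "x \<in> polys V" "y \<in> polys V" "z \<in> polys V" for x y z
      using that unfolding polys_def
      by (auto intro!: coeff_poly_br_in[where A = "\<lambda>_. V" and B = "\<lambda>_. V" and C = "\<lambda>_. V" and D = "\<lambda>_. V"] V_br)
    show "poly_br br x y z = - poly_br br y x z" if "x \<in> polys V" "y \<in> polys V" "z \<in> polys V" for x y z
    proof -
      let ?F = "\<lambda>x y z. poly_br br x y z + poly_br br y x z"
      have "?F x y z = 0"
        by (rule poly_vanish3[OF that, of ?F])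
          (auto simp: P.br_linear algebra_simps poly_br_monom add_monom
            intro!: eq_neg_iff_add_eq_0[THEN iffD1, OF skew])
      then show ?thesis
        by (simp add: eq_neg_iff_add_eq_0)
    qed
    show "poly_br br x y z + poly_br br y z x + poly_br br z x y = 0"
      if "x \<in> polys V" "y \<in> polys V" "z \<in> polys V" for x y z
      by (rule poly_vanish3[OF that, of "\<lambda>x y z. poly_br br x y z + poly_br br y z x + poly_br br z x y"])
        (auto simp: P.br_linear algebra_simps poly_br_monom add_monom
          cyclic[unfolded add.assoc])
    let ?b = "poly_br br"
    show "?b a (?b x y z) c = ?b (?b a x y) z c - ?b (?b a y x) z c - ?b (?b a z x) y c + ?b (?b a z y) x c"
      if "x \<in> polys V" "y \<in> polys V" "z \<in> polys V" for x y z a c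
    proof -
      let ?F = "\<lambda>x y z a c. ?b a (?b x y z) c
        - (?b (?b a x y) z c - ?b (?b a y x) z c - ?b (?b a z x) y c + ?b (?b a z y) x c)"
      have "?F x y z a c = 0"
        by (rule poly_vanish5[OF that, of a UNIV c UNIV ?F])
          (simp_all add: P.br_linear poly_br_monom br_mid algebra_simps flip: add_monom diff_monom)
      then show ?thesis
        by simp
    qed
    show "?b a w (?b x y z) = ?b (?b a w x) y z - ?b (?b a w y) x z - ?b (?b a w z) x y + ?b (?b a w z) y x"
      if "w \<in> polys V" "x \<in> polys V" "y \<in> polys V" "z \<in> polys V" for w x y z a
    proof -
      let ?F = "\<lambda>w x y z a. ?b a w (?b x y z)
        - (?b (?b a w x) y z - ?b (?b a w y) x z - ?b (?b a w z) x y + ?b (?b a w z) y x)"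
      have "?F w x y z a = 0"
        by (rule poly_vanish5[OF that, of a UNIV ?F])
          (simp_all add: P.br_linear poly_br_monom br_last algebra_simps flip: add_monom diff_monom)
      then show ?thesis
        by simp
    qed
  qed
qed

lemma (in lie_triple_module_char) lie_triple_module_char_poly:
  "lie_triple_module_char (scale_poly scale) (poly_br br) (polys V) p m"
  by (intro lie_triple_module_char.intro lie_triple_module_poly lie_triple_module_char_axioms.intro char p_odd)

section \<open>The Jacobson cocycle\<close>

definition jacobson_sum ::
  "('k::field \<Rightarrow> 'v::ab_group_add \<Rightarrow> 'v) \<Rightarrow> ('v \<Rightarrow> 'v \<Rightarrow> 'v \<Rightarrow> 'v) \<Rightarrow> nat \<Rightarrow> 'v \<Rightarrow> 'v \<Rightarrow> 'v"
  where "jacobson_sum scale br p x y = (\<Sum>i = 1..p - 1. jacobson_s scale br p i x y)"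

text \<open>Integration over \<open>[0, 1]\<close>, with the term of degree \<open>p - 1\<close> dropped.\<close>

definition poly_int :: "('k::field \<Rightarrow> 'v::comm_monoid_add \<Rightarrow> 'v) \<Rightarrow> nat \<Rightarrow> 'v poly \<Rightarrow> 'v"
  where "poly_int scale p q = (\<Sum>i = 1..p - 1. scale (inverse (of_nat i)) (coeff q (i - 1)))"

text \<open>The integrand is the one-form at the moving point Zx + y, evaluated on its velocity x;
  the p - 1 copies of the point are grouped into m pairs.\<close>

lemma jacobson_sum_eq_poly_int:
  "jacobson_sum scale br (Suc (2 * m)) x y
    = poly_int scale (Suc (2 * m)) (br_pow (poly_br br) [:y, x:] m [:x:])"
  using iter_br_replicate[of "poly_br br" "[:x:]" m "[:y, x:]" "[]"]
  by (simp add: jacobson_sum_def jacobson_s_def poly_int_def)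

lemma (in vector_space) poly_int_add: "poly_int scale p (P + Q) = poly_int scale p P + poly_int scale p Q"
  by (simp add: poly_int_def scale_right_distrib sum.distrib)

lemma (in vector_space) poly_int_map:
  assumes "f 0 = 0" "\<And>x y. f (x + y) = f x + f y" "\<And>c x. f (c *s x) = scale' c (f x)"
  shows "f (poly_int scale p q) = poly_int scale' p (map_poly f q)"
proof -
  have sum: "f (sum g A) = (\<Sum>i\<in>A. f (g i))" for g :: "nat \<Rightarrow> _" and A
    by (induction A rule: infinite_finite_induct) (simp_all add: assms)
  show ?thesis
    by (simp add: poly_int_def sum assms coeff_map_poly)
qed

context triple_algebra
begin

lemma jacobson_sum_hom:
  assumes "f 0 = 0" "\<And>x y. f (x + y) = f x + f y" "\<And>c x. f (c *s x) = scale' c (f x)"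
    and "triple_algebra scale' br'" "\<And>x y z. f (br x y z) = br' (f x) (f y) (f z)"
  shows "f (jacobson_sum scale br (Suc (2 * m)) x y) = jacobson_sum scale' br' (Suc (2 * m)) (f x) (f y)"
proof -
  note hom = br_pow_hom[of "map_poly f" "poly_br br" "poly_br br'", OF map_poly_br[OF assms(1,2,4,5)]]
  show ?thesis
    unfolding jacobson_sum_eq_poly_int poly_int_map[of f scale', OF assms(1-3)] hom
    by (simp add: map_poly_pCons assms(1))
qed

lemma degree_br_pow_poly:
  assumes "degree w \<le> 1" "degree h \<le> c"
  shows "degree (br_pow (poly_br br) w n h) \<le> c + 2 * n"
proof (induction n)
  case (Suc n)
  show ?case
    using degree_poly_br_le[OF Suc.IH assms(1) assms(1)] by simp
qed (use assms in simp)

text \<open>At the largest possible degree only the top coefficients contribute. For w = Zx + y this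
  is where the powers of R_x come from.\<close>

lemma coeff_br_pow_poly_top:
  assumes "degree w \<le> 1" "degree h \<le> c"
  shows "coeff (br_pow (poly_br br) w n h) (c + 2 * n) = br_pow br (coeff w 1) n (coeff h c)"
proof (induction n)
  case (Suc n)
  show ?case
    using coeff_poly_br_top[OF degree_br_pow_poly[OF assms, of n] assms(1) assms(1)] Suc.IH
    by simp
qed simp

lemma br_pow_poly_eval:
  "poly_eval scale e (br_pow (poly_br br) w n h) = br_pow br (poly_eval scale e w) n (poly_eval scale e h)"
  by (rule br_pow_hom) (rule poly_eval_br)

lemma sum_coeff_eq:
  assumes "degree P \<le> N"
  shows "(\<Sum>i\<le>N. coeff P i) = poly_eval scale 1 P"
  by (simp add: poly_eval_bound[OF assms])

lemma br_pow_deriv_shift: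
  "br_pow_deriv (poly_br br) w (pCons 0 k) n h = pCons 0 (br_pow_deriv (poly_br br) w k n h)"
proof (induction n)
  case (Suc n)
  then show ?case
    by (simp add: poly_br_shift)
qed simp

end

section \<open>Integration along a segment and the differential of the cocycle\<close>

context lie_triple_module_char
begin

lemma poly_int_deriv: "poly_int scale p (poly_deriv scale q) = (\<Sum>i = 1..p - 1. coeff q i)"
proof -
  have "inverse (of_nat i) *s coeff (poly_deriv scale q) (i - 1) = coeff q i" if "i \<in> {1..p - 1}" for i
    using that of_nat_nonzero[of i] p_odd by (simp flip: of_nat_Suc)
  then show ?thesis
    unfolding poly_int_def by (intro sum.cong) auto
qed

text \<open>With \<open>poly_int_deriv\<close> this is the fundamental theorem of calculus,
  corrected by the coefficient of Z^p, which differentiation kills in characteristic p.\<close>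

lemma sum_coeff_middle:
  assumes "degree P \<le> p"
  shows "(\<Sum>i = 1..p - 1. coeff P i) = poly_eval scale 1 P - coeff P 0 - coeff P p"
proof -
  have "{..p} = insert 0 (insert p {1..p - 1})"
    using p_odd by auto
  moreover have "p \<noteq> 0"
    using p_odd by simp
  ultimately have "(\<Sum>i\<le>p. coeff P i) = coeff P 0 + (coeff P p + (\<Sum>i = 1..p - 1. coeff P i))"
    by simp
  then show ?thesis
    by (simp add: sum_coeff_eq[OF assms])
qed

abbreviation jac :: "'v \<Rightarrow> 'v \<Rightarrow> 'v"
  where "jac \<equiv> jacobson_sum scale br p"

lemma jac_eq: "jac x y = poly_int scale p (br_pow (poly_br br) [:y, x:] m [:x:])"
  using jacobson_sum_eq_poly_int[of scale br m x y] p_odd by simp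

text \<open>This says that \<open>jac x y\<close> behaves as \<open>(x + y)\<^sup>p - x\<^sup>p - y\<^sup>p\<close>, where \<open>h \<mapsto> br_pow br x m h\<close> is
  the differential of \<open>x \<mapsto> x\<^sup>p\<close>.\<close>

lemma derivation_jac:
  assumes "triple_derivation scale br d" "\<And>x. x \<in> V \<Longrightarrow> d x \<in> V" "x \<in> V" "y \<in> V"
  shows "d (jac x y) = br_pow br (x + y) m (d (x + y)) - br_pow br x m (d x) - br_pow br y m (d y)"
proof -
  interpret triple_derivation scale br d by fact
  interpret P: lie_triple_module_char "scale_poly scale" "poly_br br" "polys V" p m
    by (rule lie_triple_module_char_poly)
  interpret D: triple_derivation "scale_poly scale" "poly_br br" "map_poly d"
    by (rule triple_derivation_map_poly)
  interpret E: triple_derivation "scale_poly scale" "poly_br br" "poly_deriv scale"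
    by (rule triple_derivation_poly_deriv)
  let ?b = "poly_br br"
  define w where "w = [:y, x:]"
  define q where "q k = br_pow ?b w m [:k:]" for k
  have w: "w \<in> polys V" "degree w \<le> 1" "poly_eval scale 1 w = x + y"
    using assms by (simp_all add: w_def add.commute)
  have dw: "poly_deriv scale w = [:x:]"
    by (intro poly_eqI) (auto simp: w_def coeff_pCons split: nat.splits)
  \<comment> \<open>Closedness of the one-form exchanges the direction \<open>k\<close> with the
    velocity \<open>x\<close> of \<open>w\<close>, which turns a derivative in direction
    \<open>k\<close> into one along the segment.\<close>
  have along: "br_pow_deriv ?b w [:k:] m [:x:] = poly_deriv scale (q k)" if "k \<in> V" for k
  proof -
    have "poly_deriv scale [:k:] = 0"
      by (intro poly_eqI) simp
    then have "poly_deriv scale (q k) = br_pow_deriv ?b w [:x:] m [:k:]"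
      by (simp add: q_def E.d_br_pow dw)
    also have "\<dots> = br_pow_deriv ?b w [:k:] m [:x:]"
      using that assms w by (intro P.br_pow_deriv_commute) auto
    finally show ?thesis ..
  qed
  have mdw: "map_poly d w = [:d y:] + pCons 0 [:d x:]"
    by (simp add: w_def map_poly_pCons)
  have "map_poly d (br_pow ?b w m [:x:])
      = q (d x) + (poly_deriv scale (q (d y)) + pCons 0 (poly_deriv scale (q (d x))))"
    unfolding D.d_br_pow mdw P.br_pow_deriv_linear br_pow_deriv_shift
    using assms by (simp add: along q_def map_poly_pCons)
  \<comment> \<open>The product rule collects the terms in \<open>q (d x)\<close> into the
    derivative of Z times \<open>q (d x)\<close>.\<close>
  also have "\<dots> = poly_deriv scale (q (d y)) + poly_deriv scale (pCons 0 (q (d x)))"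
    by (intro poly_eqI) (auto simp: coeff_pCons scale_left_distrib algebra_simps split: nat.splits)
  finally have eq: "map_poly d (br_pow ?b w m [:x:]) = \<dots>" .
  have deg: "degree (q k) \<le> 2 * m" for k
    using degree_br_pow_poly[OF w(2), of "[:k:]" 0 m] by (simp add: q_def)
  have top: "coeff (q k) (2 * m) = br_pow br x m k" for k
    using coeff_br_pow_poly_top[OF w(2), of "[:k:]" 0 m] by (simp add: q_def w_def)
  have ev: "poly_eval scale 1 (q k) = br_pow br (x + y) m k" for k
    unfolding q_def br_pow_poly_eval w(3) by simp
  have zero: "coeff (q k) 0 = br_pow br y m k" for k
    unfolding poly_eval_at_0[symmetric] q_def br_pow_poly_eval by (simp add: w_def)
  have "d (jac x y) = poly_int scale p (map_poly d (br_pow ?b w m [:x:]))"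
    unfolding jac_eq w_def by (intro poly_int_map d_zero d_add d_scale)
  also have "\<dots> = (\<Sum>i = 1..p - 1. coeff (q (d y)) i) + (\<Sum>i = 1..p - 1. coeff (pCons 0 (q (d x))) i)"
    by (simp add: eq poly_int_add poly_int_deriv)
  also have "(\<Sum>i = 1..p - 1. coeff (q (d y)) i) = br_pow br (x + y) m (d y) - br_pow br y m (d y)"
    using deg[of "d y"] p_odd by (subst sum_coeff_middle) (simp_all add: ev zero coeff_eq_0)
  \<comment> \<open>The factor Z removes the boundary term at 0 and shifts the top coefficient to
    degree p, where it gives the term at \<open>x\<close>.\<close>
  also have "(\<Sum>i = 1..p - 1. coeff (pCons 0 (q (d x))) i) = br_pow br (x + y) m (d x) - br_pow br x m (d x)"
    using deg[of "d x"] p_odd top[of "d x"]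
    by (subst sum_coeff_middle) (auto simp: ev intro: order.trans[OF degree_pCons_le])
  finally show ?thesis
    by (simp add: d_add br_pow_linear algebra_simps)
qed

text \<open>Let \<open>g\<close> be a R_w^p R_c along w = Zx + y. By
  \<open>br_pow_deriv_operator\<close> the derivative of \<open>g\<close> is the integrand of
  \<open>jac x y\<close> placed between a and c, so integration leaves the value of \<open>g\<close>
  at 1 minus its coefficients of Z^0 and Z^p.\<close>

lemma jac_operator:
  assumes "x \<in> V" "y \<in> V"
  shows "br a (jac x y) c
    = br (br_pow br (x + y) m a) (x + y) c - br (br_pow br x m a) x c - br (br_pow br y m a) y c"
proof -
  interpret P: lie_triple_module_char "scale_poly scale" "poly_br br" "polys V" p m
    by (rule lie_triple_module_char_poly)
  interpret E: triple_derivation "scale_poly scale" "poly_br br" "poly_deriv scale"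
    by (rule triple_derivation_poly_deriv)
  let ?b = "poly_br br"
  define w where "w = [:y, x:]"
  have w: "w \<in> polys V" "degree w \<le> 1" "poly_eval scale 1 w = x + y"
    using assms by (simp_all add: w_def add.commute)
  have dw: "poly_deriv scale w = [:x:]"
    by (intro poly_eqI) (auto simp: w_def coeff_pCons split: nat.splits)
  have const: "poly_deriv scale [:k:] = 0" for k
    by (intro poly_eqI) simp
  define g where "g = ?b (br_pow ?b w m [:a:]) w [:c:]"
  have "poly_deriv scale g = ?b (br_pow_deriv ?b w [:x:] m [:a:]) w [:c:] + ?b (br_pow ?b w m [:a:]) [:x:] [:c:]"
    by (simp add: g_def E.d_br E.d_br_pow const dw)
  also have "\<dots> = ?b [:a:] (br_pow ?b w m [:x:]) [:c:]"
    using assms w by (intro P.br_pow_deriv_operator) auto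
  finally have dg: "poly_deriv scale g = map_poly (\<lambda>b. br a b c) (br_pow ?b w m [:x:])"
    by (simp add: poly_br_const)
  have "br a (jac x y) c = poly_int scale p (poly_deriv scale g)"
    unfolding jac_eq dg w_def by (intro poly_int_map[of "\<lambda>b. br a b c"]) (simp_all add: br_linear)
  also have "\<dots> = poly_eval scale 1 g - coeff g 0 - coeff g p"
    unfolding poly_int_deriv
  proof (rule sum_coeff_middle)
    show "degree g \<le> p"
      using degree_poly_br_le[OF degree_br_pow_poly[OF w(2), of "[:a:]" 0 m] w(2), of "[:c:]" 0] p_odd
      by (simp add: g_def)
  qed
  also have "poly_eval scale 1 g = br (br_pow br (x + y) m a) (x + y) c"
    unfolding g_def poly_eval_br br_pow_poly_eval w(3) by simp
  also have "coeff g 0 = br (br_pow br y m a) y c"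
    unfolding poly_eval_at_0[symmetric] g_def poly_eval_br br_pow_poly_eval by (simp add: w_def)
  also have "coeff g p = br (br_pow br x m a) x c"
    using coeff_poly_br_top[OF degree_br_pow_poly[OF w(2), of "[:a:]" 0 m] w(2), of "[:c:]" 0]
      coeff_br_pow_poly_top[OF w(2), of "[:a:]" 0 m] p_odd
    by (simp add: g_def w_def)
  finally show ?thesis
    by simp
qed

section \<open>Homogeneity, symmetry and the cocycle identity\<close>

lemma jac_0 [simp]: "jac 0 y = 0" "jac x 0 = 0"
proof -
  have 1: "br_pow (poly_br br) [:0, x:] m [:x:] = monom (br_pow br x m x) (2 * m)"
  proof -
    have "br_pow (poly_br br) (monom x 1) n (monom x 0) = monom (br_pow br x n x) (2 * n)" for n
      by (induction n) (simp_all add: poly_br_monom)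
    then show ?thesis
      by (simp add: monom_Suc monom_0)
  qed
  interpret P: triple_algebra "scale_poly scale" "poly_br br"
    by (rule triple_algebra_poly)
  show "jac 0 y = 0"
    by (simp add: jac_eq poly_int_def)
  \<comment> \<open>The only possibly nonzero coefficient is in degree \<open>2 * m\<close>, that is
    p - 1, just beyond those that \<open>poly_int\<close> reads.\<close>
  show "jac x 0 = 0"
    unfolding jac_eq 1 poly_int_def using p_odd by (intro sum.neutral) auto
qed

lemma jac_scale: "jac (c *s x) (c *s y) = c ^ p *s jac x y"
proof -
  interpret P: triple_algebra "scale_poly scale" "poly_br br"
    by (rule triple_algebra_poly)
  have "br_pow (poly_br br) [:c *s y, c *s x:] m [:c *s x:]
      = br_pow (poly_br br) (scale_poly scale c [:y, x:]) m (scale_poly scale c [:x:])"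
    by simp
  also have "\<dots> = scale_poly scale (c ^ p) (br_pow (poly_br br) [:y, x:] m [:x:])"
    unfolding P.br_pow_scale P.br_pow_linear P.scale_scale by (simp add: p_odd power_commutes)
  finally show ?thesis
    by (simp add: jac_eq poly_int_def scale_sum_right mult.commute)
qed

text \<open>Skew symmetry gives [x, x, x] = 0, as 2 is invertible, so all products of multiples of x
  vanish; \<open>m_pos\<close> ensures that the integrand contains at least one product.\<close>

lemma jac_collinear:
  assumes "x \<in> V"
  shows "jac (a *s x) (b *s x) = 0"
proof -
  have 2: "(2 :: 'k) \<noteq> 0"
    using of_nat_nonzero[of 2] p_odd m_pos by simp
  have "br x x x = - br x x x"
    using assms by (intro skew) auto
  then have "2 *s br x x x = 0"
    using scale_left_distrib[of 1 1 "br x x x"] by (simp add: eq_neg_iff_add_eq_0)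
  with 2 have xxx: "br x x x = 0"
    by simp
  have zero: "poly_br br (monom (c *s x) i) Q R = 0"
    if "Q \<in> polys (range (\<lambda>c. c *s x))" "R \<in> polys (range (\<lambda>c. c *s x))" for c i Q R
  proof -
    have "poly_br br P Q R = 0" if "P \<in> polys (range (\<lambda>c. c *s x))" for P
      by (rule poly_vanish3[OF that \<open>Q \<in> _\<close> \<open>R \<in> _\<close>, of "poly_br br"])
        (auto simp: poly_br_add poly_br_monom br_linear xxx)
    moreover have "monom (c *s x) i \<in> polys (range (\<lambda>c. c *s x))"
      by (auto simp: polys_def intro: range_eqI[of _ _ 0])
    ultimately show ?thesis
      by blast
  qed
  have "c *s x \<in> range (\<lambda>c. c *s x)" for c
    by (rule rangeI)
  moreover have "0 \<in> range (\<lambda>c. c *s x)"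
    by (auto intro: range_eqI[of _ _ 0])
  ultimately have "poly_br br [:a *s x:] [:b *s x, a *s x:] [:b *s x, a *s x:] = 0"
    using zero[of "[:b *s x, a *s x:]" "[:b *s x, a *s x:]" a 0] by (simp add: monom_0)
  interpret P: triple_algebra "scale_poly scale" "poly_br br"
    by (rule triple_algebra_poly)
  obtain n where n: "m = Suc n"
    using m_pos by (cases m) auto
  have "br_pow (poly_br br) [:b *s x, a *s x:] m [:a *s x:] = 0"
    unfolding n br_pow_shift[symmetric] \<open>poly_br br [:a *s x:] _ _ = 0\<close> by (rule P.br_pow_zero)
  then show ?thesis
    by (simp add: jac_eq poly_int_def)
qed

text \<open>A zero derivative leaves only coefficients in degrees divisible by p; below p that is
  the constant term.\<close>

lemma polynomial_eq_0:
  assumes "poly_deriv scale f = 0" "coeff f 0 = 0" "degree f \<le> 2 * m"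
  shows "f = 0"
proof (rule poly_eqI)
  fix n
  show "coeff f n = coeff 0 n"
  proof (cases "n = 0 \<or> n > 2 * m")
    case True
    then show ?thesis
      using assms by (auto simp: coeff_eq_0)
  next
    case False
    then obtain k where k: "n = Suc k"
      by (cases n) auto
    have "of_nat (Suc k) *s coeff f (Suc k) = 0"
      using assms(1) coeff_poly_deriv[of f k] by simp
    moreover have "of_nat (Suc k) \<noteq> (0 :: 'k)"
      using False k p_odd by (intro of_nat_nonzero) auto
    ultimately show ?thesis
      by (simp add: k)
  qed
qed

text \<open>The outer variable is the one of integration, and the coefficients are polynomials in a
  second variable. Bounds of slope \<open>e\<close> in the outer exponent add up under products, and
  \<open>poly_int\<close> stops at outer exponent \<open>2 * m - 1\<close>, which keeps the degree
  below p in the applications.\<close>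

lemma degree_poly_int_br_pow:
  assumes "\<And>n. degree (coeff W n) \<le> e * n + d" "\<And>n. degree (coeff H n) \<le> e * n + c"
    and "e * (2 * m - 1) + c + 2 * m * d \<le> N"
  shows "degree (poly_int (scale_poly scale) p (br_pow (poly_br (poly_br br)) W m H)) \<le> N"
proof -
  define A where "A c n = {q :: 'v poly. degree q \<le> e * n + c}" for c n
  have "\<forall>n. coeff (br_pow (poly_br (poly_br br)) W k H) n \<in> A (c + 2 * k * d) n" for k
  proof (induction k)
    case (Suc k)
    have "coeff (poly_br (poly_br br) (br_pow (poly_br (poly_br br)) W k H) W W) n \<in> A (c + 2 * Suc k * d) n" for n
    proof (rule coeff_poly_br_in[where A = "A (c + 2 * k * d)" and B = "A d" and C = "A d"])
      show "poly_br br P Q R \<in> A (c + 2 * Suc k * d) (i + j + l)"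
        if "P \<in> A (c + 2 * k * d) i" "Q \<in> A d j" "R \<in> A d l" for P Q R i j l
      proof -
        have "degree (poly_br br P Q R) \<le> (e * i + (c + 2 * k * d)) + (e * j + d) + (e * l + d)"
          using that unfolding A_def by (intro degree_poly_br_le) auto
        then show ?thesis
          by (simp add: A_def algebra_simps)
      qed
    qed (use Suc.IH assms in \<open>auto simp: A_def intro: degree_add_le\<close>)
    then show ?case
      by simp
  qed (use assms in \<open>simp add: A_def\<close>)
  then have deg: "degree (coeff (br_pow (poly_br (poly_br br)) W m H) n) \<le> e * n + (c + 2 * m * d)" for n
    by (simp add: A_def)
  have scale: "degree (scale_poly scale c P) \<le> degree P" for c P
    by (intro degree_le) (simp add: coeff_eq_0)
  show ?thesis
    unfolding poly_int_def
  proof (intro degree_sum_le)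
    fix i assume i: "i \<in> {1..p - 1}"
    then have "i - 1 \<le> 2 * m - 1"
      using p_odd by auto
    then have "e * (i - 1) \<le> e * (2 * m - 1)"
      by (rule mult_le_mono2)
    then show "degree (scale_poly scale (inverse (of_nat i))
        (coeff (br_pow (poly_br (poly_br br)) W m H) (i - 1))) \<le> N"
      using assms(3) by (intro order.trans[OF order.trans[OF scale deg[of "i - 1"]]]) linarith
  qed simp
qed

lemma jac_poly_hom:
  "poly_eval scale e (jacobson_sum (scale_poly scale) (poly_br br) p X Y) = jac (poly_eval scale e X) (poly_eval scale e Y)"
proof -
  interpret P: triple_algebra "scale_poly scale" "poly_br br"
    by (rule triple_algebra_poly)
  show ?thesis
    unfolding p_odd
    by (rule P.jacobson_sum_hom[OF _ _ _ triple_algebra_axioms])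
      (simp_all add: poly_eval_add poly_eval_scale poly_eval_br)
qed

lemma jac_commute:
  assumes "x \<in> V" "y \<in> V"
  shows "jac x y = jac y x"
proof -
  interpret P: lie_triple_module_char "scale_poly scale" "poly_br br" "polys V" p m
    by (rule lie_triple_module_char_poly)
  interpret E: triple_derivation "scale_poly scale" "poly_br br" "poly_deriv scale"
    by (rule triple_derivation_poly_deriv)
  \<comment> \<open>The element \<open>x\<close> is scaled by a new variable. By
    \<open>derivation_jac\<close> both orders then have the same derivative, and both vanish when
    the variable is 0.\<close>
  define X Y where "X = [:0, x:]" and "Y = [:y:]"
  have XY: "X \<in> polys V" "Y \<in> polys V"
    using assms by (simp_all add: X_def Y_def)
  have dV: "poly_deriv scale P \<in> polys V" if "P \<in> polys V" for P
    using that by (simp add: polys_def)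
  note jac_d = P.derivation_jac[OF E.triple_derivation_axioms dV]
  have "P.jac X Y - P.jac Y X = 0"
  proof (rule polynomial_eq_0)
    show "poly_deriv scale (P.jac X Y - P.jac Y X) = 0"
      using XY by (simp add: E.d_diff jac_d add.commute)
    show "coeff (P.jac X Y - P.jac Y X) 0 = 0"
      unfolding coeff_diff unfolding poly_eval_at_0[symmetric] jac_poly_hom by (simp add: X_def)
    \<comment> \<open>At the point ZX + Y the new variable occurs only together with Z, so
      \<open>e = 1\<close>, and \<open>c = 1\<close> is for the leading entry X; at ZY + X it occurs
      without Z, so \<open>d = 1\<close>.\<close>
    have "degree (P.jac X Y) \<le> 2 * m"
      unfolding P.jac_eq
      by (rule degree_poly_int_br_pow[where e = 1 and d = 0 and c = 1])
        (use m_pos in \<open>auto simp: X_def Y_def coeff_pCons split: nat.splits\<close>)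
    moreover have "degree (P.jac Y X) \<le> 2 * m"
      unfolding P.jac_eq
      by (rule degree_poly_int_br_pow[where e = 0 and d = 1 and c = 0])
        (auto simp: X_def Y_def coeff_pCons split: nat.splits)
    ultimately show "degree (P.jac X Y - P.jac Y X) \<le> 2 * m"
      by (rule degree_diff_le)
  qed
  then have "poly_eval scale 1 (P.jac X Y) = poly_eval scale 1 (P.jac Y X)"
    by simp
  then show ?thesis
    unfolding jac_poly_hom by (simp add: X_def Y_def)
qed

text \<open>By \<open>derivation_jac\<close> both sides have as derivative the one-form at x + y + z
  minus those at x, y and z, so the argument for \<open>jac_commute\<close> applies again.\<close>

lemma jac_cocycle:
  assumes "x \<in> V" "y \<in> V" "z \<in> V"
  shows "jac x y + jac (x + y) z = jac y z + jac x (y + z)"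
proof -
  interpret P: lie_triple_module_char "scale_poly scale" "poly_br br" "polys V" p m
    by (rule lie_triple_module_char_poly)
  interpret E: triple_derivation "scale_poly scale" "poly_br br" "poly_deriv scale"
    by (rule triple_derivation_poly_deriv)
  define X Y Z where "X = [:0, x:]" and "Y = [:y:]" and "Z = [:z:]"
  have XYZ: "X \<in> polys V" "Y \<in> polys V" "Z \<in> polys V" "X + Y \<in> polys V" "Y + Z \<in> polys V"
    using assms by (simp_all add: X_def Y_def Z_def)
  have dV: "poly_deriv scale P \<in> polys V" if "P \<in> polys V" for P
    using that by (simp add: polys_def)
  note jac_d = P.derivation_jac[OF E.triple_derivation_axioms dV]
  define f where "f = P.jac X Y + P.jac (X + Y) Z - (P.jac Y Z + P.jac X (Y + Z))"
  have "f = 0"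
  proof (rule polynomial_eq_0)
    show "poly_deriv scale f = 0"
      using XYZ by (simp add: f_def E.d_diff E.d_add jac_d add.assoc)
    show "coeff f 0 = 0"
      unfolding f_def coeff_diff coeff_add unfolding poly_eval_at_0[symmetric] jac_poly_hom poly_eval_add
      by (simp add: X_def)
    \<comment> \<open>In every term the second argument is constant in the new variable, so one
      bound covers all four.\<close>
    have lin: "degree (P.jac A B) \<le> 2 * m" if "degree A \<le> 1" "degree B = 0" for A B
      unfolding P.jac_eq
      by (rule degree_poly_int_br_pow[where e = 1 and d = 0 and c = 1])
        (use m_pos that in \<open>auto simp: coeff_pCons split: nat.splits\<close>)
    show "degree f \<le> 2 * m"
      unfolding f_def by (intro degree_diff_le degree_add_le lin) (simp_all add: X_def Y_def Z_def)
  qed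
  then have "poly_eval scale 1 (P.jac X Y + P.jac (X + Y) Z)
      = poly_eval scale 1 (P.jac Y Z + P.jac X (Y + Z))"
    by (simp add: f_def)
  then show ?thesis
    unfolding poly_eval_add jac_poly_hom by (simp add: X_def Y_def Z_def)
qed

end

section \<open>The Lie triple system generated by a component of degree in \<open>G\<^sub>+\<close>\<close>

lemma nat_mult_simps [simp]: "nat_mult 0 \<gamma> = 0" "nat_mult (Suc n) \<gamma> = \<gamma> + nat_mult n \<gamma>"
  unfolding nat_mult_def by (simp_all add: add.commute)

lemma nat_mult_add: "nat_mult (m + n) \<gamma> = nat_mult m \<gamma> + nat_mult n \<gamma>"
  by (induction m) (simp_all add: add.assoc)

context bicharacter
begin

lemma zero_left [simp]: "\<epsilon> 0 \<alpha> = 1"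
  using add_left[of 0 0 \<alpha>] nonzero[of 0 \<alpha>] by simp

lemma zero_right [simp]: "\<epsilon> \<alpha> 0 = 1"
  using add_right[of \<alpha> 0 0] nonzero[of \<alpha> 0] by simp

lemma nat_mult_left: "\<epsilon> (nat_mult n \<gamma>) \<alpha> = \<epsilon> \<gamma> \<alpha> ^ n"
  by (induction n) (simp_all add: add_left)

lemma nat_mult_right: "\<epsilon> \<alpha> (nat_mult n \<gamma>) = \<epsilon> \<alpha> \<gamma> ^ n"
  by (induction n) (simp_all add: add_right)

end

lemma (in vector_space) span_add_closure:
  assumes "\<And>c x. x \<in> S \<Longrightarrow> c *s x \<in> S" "x \<in> span S"
  shows "x \<in> add_closure S"
  using assms(2) by (induction rule: span_induct_alt) (use assms(1) in \<open>auto intro: add_closure.intros\<close>)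

context lie_color_triple_system
begin

sublocale triple_algebra scale br
  using trilinear unfolding trilinear_def Vector_Spaces.linear_iff by unfold_locales auto

lemma T_subspace: "subspace (T i)"
  using grading by (simp add: grading_def)

lemma T_closed: "0 \<in> T i" "x \<in> T i \<Longrightarrow> y \<in> T i \<Longrightarrow> x + y \<in> T i" "x \<in> T i \<Longrightarrow> c *s x \<in> T i"
  using T_subspace[of i] by (auto simp: subspace_def)

lemma homogeneous_add_closure: "x \<in> add_closure (\<Union>i. T i)"
proof -
  obtain f where f: "\<And>\<gamma>. f \<gamma> \<in> T \<gamma>" "x = (\<Sum>\<gamma> | f \<gamma> \<noteq> 0. f \<gamma>)"
    using grading unfolding grading_def by blast
  have "sum f A \<in> add_closure (\<Union>i. T i)" for A
    by (induction A rule: infinite_finite_induct) (use f in \<open>auto intro: add_closure.intros\<close>)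
  then show ?thesis
    by (simp add: f(2))
qed

text \<open>The cyclic identity is solved for its first term, with \<open>br_skew\<close> applied to
  the second. This brings the last entry to the front, where right multiplications act.\<close>

lemma br_reverse:
  assumes "x \<in> T i" "y \<in> T j" "z \<in> T k"
  shows "br x y z = \<epsilon> (i + j) k *s (\<epsilon> i j *s br z y x - br z x y)"
proof -
  have "\<epsilon> k i *s br x y z + \<epsilon> i j *s br y z x + \<epsilon> j k *s br z x y = 0"
    by (rule br_cyclic[OF assms])
  moreover have "br y z x = - (\<epsilon> j k *s br z y x)"
    by (rule br_skew[OF assms(2,3,1)])
  ultimately have "\<epsilon> k i *s br x y z = \<epsilon> j k *s (\<epsilon> i j *s br z y x - br z x y)"
    by (simp add: algebra_simps add_eq_0_iff)
  then have "\<epsilon> i k *s \<epsilon> k i *s br x y z = \<epsilon> i k *s \<epsilon> j k *s (\<epsilon> i j *s br z y x - br z x y)"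
    by (simp only:)
  then show ?thesis
    by (simp only: scale_scale mult_swap add_left scale_one)
qed

lemma br_reverse':
  assumes "\<epsilon> i j = 1" "x \<in> T i" "y \<in> T j" "z \<in> T k"
  shows "br x y z = \<epsilon> (i + j) k *s (br z y x - br z x y)"
  using br_reverse[OF assms(2-4)] assms(1) by simp

text \<open>The pair a, w acts as a derivation; in the two terms where the module element a is not
  in front, \<open>br_skew\<close> and \<open>br_reverse'\<close> bring it there, and the signs
  cancel by \<open>mult_swap\<close>.\<close>

lemma homogeneous_br_last:
  assumes "\<epsilon> i j = 1" "\<epsilon> i k = 1" "\<epsilon> j k = 1"
    and "a \<in> T n" "w \<in> T l" "x \<in> T i" "y \<in> T j" "z \<in> T k"
  shows "br a w (br x y z) = br (br a w x) y z - br (br a w y) x z - br (br a w z) x y + br (br a w z) y x"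
proof -
  have A: "br a w y \<in> T (n + l + j)" and B: "br a w z \<in> T (n + l + k)"
    using assms by (auto intro: br_in)
  have "br x (br a w y) z = - (\<epsilon> i (n + l + j) *s br (br a w y) x z)"
    using assms A by (intro br_skew)
  then have 1: "\<epsilon> (n + l) i *s br x (br a w y) z = - br (br a w y) x z"
    using assms mult_swap[of "n + l" i] by (simp add: add_right[of i "n + l"])
  have "br x y (br a w z) = \<epsilon> (i + j) (n + l + k) *s (br (br a w z) y x - br (br a w z) x y)"
    using assms B by (intro br_reverse')
  then have 2: "\<epsilon> (n + l) (i + j) *s br x y (br a w z) = br (br a w z) y x - br (br a w z) x y"
    using assms mult_swap[of "n + l" "i + j"]
    by (simp add: add_right[of "i + j" "n + l"] add_left[of i j k] del: scale_right_diff_distrib)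
  show ?thesis
    unfolding br_derivation[OF assms(4-8)] 1 2 by (simp add: algebra_simps)
qed

text \<open>The derivation identity for x, y on [a, z, c] is solved for the term with [x, y, z] in
  the middle. The other terms are rewritten with a or c in front, and the derivation identity for a,
  z accounts for those that involve products starting with c.\<close>

lemma homogeneous_br_mid:
  assumes ij: "\<epsilon> i j = 1" and ik: "\<epsilon> i k = 1" and jk: "\<epsilon> j k = 1"
    and a: "a \<in> T n" and c: "c \<in> T l" and x: "x \<in> T i" and y: "y \<in> T j" and z: "z \<in> T k"
  shows "br a (br x y z) c = br (br a x y) z c - br (br a y x) z c - br (br a z x) y c + br (br a z y) x c"
proof -
  have ji: "\<epsilon> j i = 1" and ki: "\<epsilon> k i = 1" and kj: "\<epsilon> k j = 1"
    using ij ik jk mult_swap[of i j] mult_swap[of i k] mult_swap[of j k] by auto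
  define e where "e = \<epsilon> (i + j) n"
  define f where "f = \<epsilon> (i + j) l"
  define g where "g = \<epsilon> (n + k) l"
  have e: "e \<noteq> 0"
    by (simp add: e_def nonzero)
  have X: "br a z x \<in> T (n + k + i)" and Y: "br a z y \<in> T (n + k + j)" and E: "br a z c \<in> T (n + k + l)"
    using assms by (auto intro: br_in)
  have 1: "br x y (br a z c) = (e * f) *s (br (br a z c) y x - br (br a z c) x y)"
    using br_reverse'[OF ij x y E] ik jk by (simp add: e_def f_def add_left add_right mult_ac)
  have 2: "br (br x y a) z c = e *s (br (br a y x) z c - br (br a x y) z c)"
    unfolding br_reverse'[OF ij x y a] by (simp add: e_def br_linear)
  have 3: "br a z (br x y c) = f *s (br a z (br c y x) - br a z (br c x y))"
    unfolding br_reverse'[OF ij x y c] by (simp add: f_def br_linear)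
  have der: "br a z (br c u v) = br (br a z c) u v + g *s br c (br a z u) v + (g * \<epsilon> (n + k) r) *s br c u (br a z v)"
    if "u \<in> T r" "v \<in> T s" for u v r s
    using br_derivation[OF a z c that] by (simp add: g_def add_right)
  have left: "br (br a z u) v c = (f * g) *s (\<epsilon> (n + k) s *s br c v (br a z u) - br c (br a z u) v)"
    if u: "u \<in> T r" and v: "v \<in> T s" and "\<epsilon> r s = 1" "r + s = i + j" for u v r s
  proof -
    have U: "br a z u \<in> T (n + k + r)"
      using a z u by (rule br_in)
    have "f * g = \<epsilon> (n + k + r) l * \<epsilon> s l"
      using that(4) by (simp add: f_def g_def add_left[of "n + k" r] flip: add_left[of r s])
    moreover have "\<epsilon> (n + k) s = \<epsilon> (n + k + r) s"
      using that(3) by (simp add: add_left[of "n + k" r])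
    moreover have "br (br a z u) v c = (\<epsilon> (n + k + r) l * \<epsilon> s l) *s
        (\<epsilon> (n + k + r) s *s br c v (br a z u) - br c (br a z u) v)"
      using br_reverse[OF U v c] by (simp only: add_left[of _ s])
    ultimately show ?thesis
      by (simp only:)
  qed
  have "br x y (br a z c) = br (br x y a) z c + e *s br a (br x y z) c + (e * 1) *s br a z (br x y c)"
    using br_derivation[OF x y a z c] ik jk by (simp add: e_def add_right add_left)
  then have "e *s br a (br x y z) c = e *s (f *s (br (br a z c) y x - br (br a z c) x y)
      - (br (br a y x) z c - br (br a x y) z c) - f *s (br a z (br c y x) - br a z (br c x y)))"
    unfolding 1 2 3 by (simp add: algebra_simps)
  then have "br a (br x y z) c = f *s (br (br a z c) y x - br (br a z c) x y)
      - (br (br a y x) z c - br (br a x y) z c) - f *s (br a z (br c y x) - br a z (br c x y))"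
    using e by simp
  also have "\<dots> = br (br a x y) z c - br (br a y x) z c - br (br a z x) y c + br (br a z y) x c"
    unfolding der[OF x y] der[OF y x] left[OF x y ij refl] left[OF y x ji add.commute]
    by (simp add: algebra_simps)
  finally show ?thesis .
qed

text \<open>The subsystem generated by \<open>T \<gamma>\<close> lies in this space, on which all signs are trivial.\<close>

definition multiples :: "'g \<Rightarrow> 'v set"
  where "multiples \<gamma> = (\<Union>n. T (nat_mult n \<gamma>))"

lemma multiples_add_closure: "x \<in> span (multiples \<gamma>) \<Longrightarrow> x \<in> add_closure (multiples \<gamma>)"
  by (rule span_add_closure) (auto simp: multiples_def intro: T_closed)

text \<open>Multiples of \<gamma> pair to 1 under \<epsilon>, so on homogeneous generators the color
  identities lose their signs. The outer entries a and c of the module axioms may have any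
  degree.\<close>

lemma lie_triple_module_multiples:
  assumes "\<epsilon> \<gamma> \<gamma> = 1"
  shows "lie_triple_module scale br (span (multiples \<gamma>))"
proof
  let ?H = "multiples \<gamma>"
  note closure = multiples_add_closure[of _ \<gamma>]
  have eps: "\<epsilon> (nat_mult i \<gamma>) (nat_mult j \<gamma>) = 1" for i j
    by (simp add: nat_mult_left nat_mult_right assms)
  show "subspace (span ?H)"
    by (rule subspace_span)
  have H: "br x y z \<in> ?H" if xyz: "x \<in> ?H" "y \<in> ?H" "z \<in> ?H" for x y z
  proof -
    obtain i j k where "x \<in> T (nat_mult i \<gamma>)" "y \<in> T (nat_mult j \<gamma>)" "z \<in> T (nat_mult k \<gamma>)"
      using xyz unfolding multiples_def by blast
    then have "br x y z \<in> T (nat_mult (i + j + k) \<gamma>)"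
      unfolding nat_mult_add by (rule br_in)
    then show ?thesis
      unfolding multiples_def by blast
  qed
  show "br x y z \<in> span ?H" if "x \<in> span ?H" "y \<in> span ?H" "z \<in> span ?H" for x y z
  proof -
    have 1: "br x y z \<in> span ?H" if "y \<in> ?H" "z \<in> ?H" for y z
      using \<open>x \<in> span ?H\<close> that
      by (induction rule: span_induct_alt) (auto simp: br_linear intro: H span_add span_scale span_base span_zero)
    have 2: "br x y z \<in> span ?H" if "z \<in> ?H" for z
      using \<open>y \<in> span ?H\<close> that
      by (induction rule: span_induct_alt) (auto simp: br_linear intro: 1 span_add span_scale span_zero)
    show ?thesis
      using \<open>z \<in> span ?H\<close>
      by (induction rule: span_induct_alt) (auto simp: br_linear intro: 2 span_add span_scale span_zero)
  qed
  show "br x y z = - br y x z" if "x \<in> span ?H" "y \<in> span ?H" "z \<in> span ?H" for x y z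
  proof -
    have "br x y z + br y x z = 0"
    proof (rule additive_vanish3[OF that[THEN closure], of "\<lambda>x y z. br x y z + br y x z"])
      show "br x y z + br y x z = 0" if "x \<in> ?H" "y \<in> ?H" "z \<in> ?H" for x y z
        using that unfolding multiples_def by (auto simp: eps dest: br_skew)
    qed (simp_all add: br_linear algebra_simps)
    then show ?thesis
      by (simp add: eq_neg_iff_add_eq_0)
  qed
  show "br x y z + br y z x + br z x y = 0" if "x \<in> span ?H" "y \<in> span ?H" "z \<in> span ?H" for x y z
  proof (rule additive_vanish3[OF that[THEN closure], of "\<lambda>x y z. br x y z + br y z x + br z x y"])
    show "br x y z + br y z x + br z x y = 0" if "x \<in> ?H" "y \<in> ?H" "z \<in> ?H" for x y z
      using that unfolding multiples_def by (auto dest: br_cyclic[of x _ y _ z] simp: eps)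
  qed (simp_all add: br_linear algebra_simps)
  show "br a (br x y z) c = br (br a x y) z c - br (br a y x) z c - br (br a z x) y c + br (br a z y) x c"
    if "x \<in> span ?H" "y \<in> span ?H" "z \<in> span ?H" for x y z a c
  proof -
    let ?F = "\<lambda>x y z a c. br a (br x y z) c
      - (br (br a x y) z c - br (br a y x) z c - br (br a z x) y c + br (br a z y) x c)"
    have "?F x y z a c = 0"
    proof (rule additive_vanish5[OF that[THEN closure] homogeneous_add_closure homogeneous_add_closure, of ?F])
      show "?F x y z a c = 0" if "x \<in> ?H" "y \<in> ?H" "z \<in> ?H" "a \<in> (\<Union>i. T i)" "c \<in> (\<Union>i. T i)" for x y z a c
        using that homogeneous_br_mid[OF eps eps eps] unfolding multiples_def
          by (elim UN_E) simp
    qed (simp_all add: br_linear algebra_simps)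
    then show ?thesis
      by simp
  qed
  show "br a w (br x y z) = br (br a w x) y z - br (br a w y) x z - br (br a w z) x y + br (br a w z) y x"
    if "w \<in> span ?H" "x \<in> span ?H" "y \<in> span ?H" "z \<in> span ?H" for w x y z a
  proof -
    let ?F = "\<lambda>w x y z a. br a w (br x y z)
      - (br (br a w x) y z - br (br a w y) x z - br (br a w z) x y + br (br a w z) y x)"
    have "?F w x y z a = 0"
    proof (rule additive_vanish5[OF that[THEN closure] homogeneous_add_closure, of ?F])
      show "?F w x y z a = 0" if "w \<in> ?H" "x \<in> ?H" "y \<in> ?H" "z \<in> ?H" "a \<in> (\<Union>i. T i)" for w x y z a
        using that homogeneous_br_last[OF eps eps eps] unfolding multiples_def
          by (elim UN_E) simp
    qed (simp_all add: br_linear algebra_simps)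
    then show ?thesis
      by simp
  qed
qed

lemma T_subset_multiples: "T \<gamma> \<subseteq> span (multiples \<gamma>)"
proof -
  have "T (nat_mult 1 \<gamma>) \<subseteq> multiples \<gamma>"
    unfolding multiples_def by blast
  then show ?thesis
    using span_superset[of "multiples \<gamma>"] by auto
qed

end

section \<open>Trivializing a cocycle along a basis\<close>

lemma (in vector_space) exists_projection:
  assumes "subspace W"
  obtains \<pi> where "\<And>x. \<pi> x \<in> W" "\<And>x. x \<in> W \<Longrightarrow> \<pi> x = x"
    "\<And>x y. \<pi> (x + y) = \<pi> x + \<pi> y" "\<And>c x. \<pi> (c *s x) = c *s \<pi> x"
proof -
  interpret vector_space_pair scale scale ..
  have "\<exists>g. g ` UNIV \<subseteq> W \<and> Vector_Spaces.linear scale scale g \<and> (\<forall>v\<in>W. g (id v) = v)"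
    by (rule linear_exists_left_inverse_on[OF linear_id assms]) simp
  then obtain g where "range g \<subseteq> W" "Vector_Spaces.linear scale scale g" "\<And>v. v \<in> W \<Longrightarrow> g v = v"
    by auto
  then show thesis
    by (intro that[of g]) (auto simp: Vector_Spaces.linear_iff)
qed

text \<open>A symmetric cocycle \<open>S\<close> defines an extension of abelian groups. Together with \<open>c (x, a) = (c x, c\<^sup>p a)\<close>
  it is a vector space, since \<open>S\<close> vanishes on lines, so \<open>u i \<mapsto> (u i, v i)\<close> has a unique linear extension.\<close>

lemma (in vector_space) cocycle_trivialization:
  fixes S :: "'b \<Rightarrow> 'b \<Rightarrow> 'b" and u :: "'i \<Rightarrow> 'b"
  assumes basis: "basis_family J u W" and p: "CHAR('a) = p" "prime p"
    and comm: "\<And>x y. x \<in> W \<Longrightarrow> y \<in> W \<Longrightarrow> S x y = S y x"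
    and cocycle: "\<And>x y z. x \<in> W \<Longrightarrow> y \<in> W \<Longrightarrow> z \<in> W \<Longrightarrow> S x y + S (x + y) z = S y z + S x (y + z)"
    and homogeneous: "\<And>c x y. x \<in> W \<Longrightarrow> y \<in> W \<Longrightarrow> S (c *s x) (c *s y) = c ^ p *s S x y"
    and lines: "\<And>a b x. x \<in> W \<Longrightarrow> S (a *s x) (b *s x) = 0"
  obtains P where "\<And>x y. x \<in> W \<Longrightarrow> y \<in> W \<Longrightarrow> P (x + y) = P x + P y + S x y"
    "\<And>c x. x \<in> W \<Longrightarrow> P (c *s x) = c ^ p *s P x" "\<And>i. i \<in> J \<Longrightarrow> P (u i) = v i"
proof -
  have inj: "inj_on u J" and ind: "independent (u ` J)" and span: "span (u ` J) = W"
    using basis by (auto simp: basis_family_def)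
  have W: "subspace W"
    using span by (metis subspace_span)
  obtain \<pi> where \<pi>: "\<And>x. \<pi> x \<in> W" "\<And>x. x \<in> W \<Longrightarrow> \<pi> x = x"
    "\<And>x y. \<pi> (x + y) = \<pi> x + \<pi> y" "\<And>c x. \<pi> (c *s x) = c *s \<pi> x"
    using exists_projection[OF W] by blast
  have \<pi>0: "\<pi> 0 = 0"
    using \<pi>(4)[of 0 0] by simp
  \<comment> \<open>Projecting the first components before applying \<open>S\<close> makes
    \<open>ext\<close> associative and commutative on all pairs, so that finite sums are available
    on the whole type.\<close>
  define ext where "ext q r = (fst q + fst r, snd q + snd r + S (\<pi> (fst q)) (\<pi> (fst r)))" for q r :: "'b \<times> 'b"
  define act where "act c q = (c *s fst q, c ^ p *s snd q)" for c and q :: "'b \<times> 'b"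
  have S0: "S (\<pi> x) 0 = 0" for x
    using lines[OF \<pi>(1), of 1 x 0] by simp
  interpret E: comm_monoid_set ext "(0, 0)"
  proof
    fix q r s :: "'b \<times> 'b"
    have "S (\<pi> (fst q)) (\<pi> (fst r)) + S (\<pi> (fst q) + \<pi> (fst r)) (\<pi> (fst s))
        = S (\<pi> (fst r)) (\<pi> (fst s)) + S (\<pi> (fst q)) (\<pi> (fst r) + \<pi> (fst s))"
      by (intro cocycle \<pi>)
    then show "ext (ext q r) s = ext q (ext r s)"
      by (simp add: ext_def \<pi> algebra_simps)
    show "ext q r = ext r q"
      using comm[OF \<pi>(1) \<pi>(1)] by (simp add: ext_def add_ac)
    show "ext q (0, 0) = q"
      by (simp add: ext_def \<pi>0 S0)
  qed
  have act_ext: "act c (ext q r) = ext (act c q) (act c r)" for c q r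
    by (simp add: ext_def act_def \<pi> homogeneous scale_right_distrib)
  have act_F: "act c (E.F g I) = E.F (\<lambda>i. act c (g i)) I" for c g I
    by (induction I rule: infinite_finite_induct) (simp_all add: act_ext, simp_all add: act_def)
  define co where "co x i = representation (u ` J) x (u i)" for x i
  define t where "t x i = act (co x i) (u i, v i)" for x i
  define supp where "supp x = {i \<in> J. co x i \<noteq> 0}" for x
  define P where "P x = snd (E.F (t x) (supp x))" for x
  have p0: "p \<noteq> 0"
    using p by auto
  have fin: "finite (supp x)" for x
  proof (rule finite_imageD)
    show "finite (u ` supp x)"
      by (rule finite_subset[OF _ finite_representation[of "u ` J" x]]) (auto simp: supp_def co_def)
    show "inj_on u (supp x)"
      using inj by (rule inj_on_subset) (auto simp: supp_def)
  qed
  have uW: "u i \<in> W" if "i \<in> J" for i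
    using that span span_base by blast
  have F_supp: "E.F (t x) (supp x) = E.F (t x) I" if "finite I" "supp x \<subseteq> I" "I \<subseteq> J" for x I
    using that p0 by (intro E.mono_neutral_left) (auto simp: t_def act_def supp_def)
  have fst_F: "fst (E.F g I) = (\<Sum>i\<in>I. fst (g i))" for g and I :: "'i set"
    by (induction I rule: infinite_finite_induct) (simp_all add: ext_def)
  have F: "E.F (t x) (supp x) = (x, P x)" if "x \<in> W" for x
  proof -
    have "fst (E.F (t x) (supp x)) = (\<Sum>i\<in>supp x. co x i *s u i)"
      by (simp add: fst_F t_def act_def)
    also have "\<dots> = (\<Sum>b\<in>u ` supp x. representation (u ` J) x b *s b)"
      using inj by (subst sum.reindex) (auto simp: co_def supp_def intro: inj_on_subset)
    also have "u ` supp x = {b. representation (u ` J) x b \<noteq> 0}"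
      using representation_ne_zero[of "u ` J" x] by (auto simp: supp_def co_def)
    also have "(\<Sum>b | representation (u ` J) x b \<noteq> 0. representation (u ` J) x b *s b) = x"
      using ind that span by (intro sum_nonzero_representation_eq) auto
    finally show ?thesis
      by (simp add: P_def prod_eq_iff)
  qed
  show thesis
  proof (rule that[of P])
    fix x y assume xy: "x \<in> W" "y \<in> W"
    then have xy': "x + y \<in> W"
      using W by (auto simp: subspace_def)
    define I where "I = supp x \<union> supp y \<union> supp (x + y)"
    have I: "finite I" "I \<subseteq> J" "supp x \<subseteq> I" "supp y \<subseteq> I" "supp (x + y) \<subseteq> I"
      using fin by (auto simp: I_def supp_def)
    have co: "co (x + y) i = co x i + co y i" for i
      using ind xy span by (simp add: co_def representation_add)
    have dream: "(a + b) ^ p = a ^ p + b ^ p" for a b :: 'a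
      using p by (intro freshmans_dream) auto
    \<comment> \<open>For each i both summands lie over the line of \<open>u i\<close>, where
      \<open>S\<close> vanishes, and the p-th powers of the coefficients add by
      \<open>dream\<close>.\<close>
    have "t (x + y) i = ext (t x i) (t y i)" if "i \<in> I" for i
    proof -
      have "u i \<in> W"
        using that I(2) uW by blast
      then have "\<pi> (u i) = u i" "S (a *s u i) (b *s u i) = 0" for a b
        by (simp_all only: \<pi> lines)
      then show ?thesis
        by (simp add: t_def ext_def act_def co dream scale_left_distrib \<pi>(4))
    qed
    then have "E.F (t (x + y)) I = E.F (\<lambda>i. ext (t x i) (t y i)) I"
      by (rule E.cong[OF refl])
    also have "\<dots> = ext (E.F (t x) I) (E.F (t y) I)"
      by (rule E.distrib)
    finally have "(x + y, P (x + y)) = ext (x, P x) (y, P y)"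
      using F[OF xy(1)] F[OF xy(2)] F[OF xy'] F_supp[OF I(1)] I by simp
    then show "P (x + y) = P x + P y + S x y"
      by (simp add: ext_def \<pi> xy)
  next
    fix c x assume x: "x \<in> W"
    then have cx: "c *s x \<in> W"
      using W by (auto simp: subspace_def)
    define I where "I = supp x \<union> supp (c *s x)"
    have I: "finite I" "I \<subseteq> J" "supp x \<subseteq> I" "supp (c *s x) \<subseteq> I"
      using fin by (auto simp: I_def supp_def)
    have "t (c *s x) i = act c (t x i)" for i
      using ind x span by (simp add: t_def act_def co_def representation_scale power_mult_distrib)
    then have "E.F (t (c *s x)) I = act c (E.F (t x) I)"
      by (simp add: act_F)
    then have "(c *s x, P (c *s x)) = act c (x, P x)"
      using F[OF x] F[OF cx] F_supp[OF I(1)] I by simp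
    then show "P (c *s x) = c ^ p *s P x"
      by (simp add: act_def)
  next
    fix i assume i: "i \<in> J"
    then have co: "co (u i) j = (if j = i then 1 else 0)" if "j \<in> J" for j
      using that ind inj by (auto simp: co_def representation_basis dest: inj_onD)
    then have "supp (u i) = {i}"
      using i by (auto simp: supp_def split: if_splits)
    then show "P (u i) = v i"
      using co[OF i] by (simp add: P_def t_def act_def)
  qed
qed


section \<open>Existence and uniqueness of the restricted structure\<close>

context lie_color_triple_system
begin

text \<open>All coefficients of Zx + y lie in \<open>T \<gamma>\<close>, so each pair of factors
  adds 2\<gamma> to the degree, whatever the power of Z.\<close>

lemma jacobson_sum_in_T:
  assumes "x \<in> T \<gamma>" "y \<in> T \<gamma>"
  shows "jacobson_sum scale br (Suc (2 * m)) x y \<in> T (nat_mult (Suc (2 * m)) \<gamma>)"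
proof -
  have lin: "coeff [:y, x:] n \<in> T \<gamma>" "coeff [:x:] n \<in> T \<gamma>" for n
    using assms T_closed by (auto simp: coeff_pCons split: nat.splits)
  have "\<forall>n. coeff (br_pow (poly_br br) [:y, x:] k [:x:]) n \<in> T (nat_mult (Suc (2 * k)) \<gamma>)" for k
  proof (induction k)
    case (Suc k)
    have "coeff (poly_br br (br_pow (poly_br br) [:y, x:] k [:x:]) [:y, x:] [:y, x:]) n
        \<in> T (nat_mult (Suc (2 * k)) \<gamma> + \<gamma> + \<gamma>)" for n
      by (rule coeff_poly_br_in[where A = "\<lambda>_. T (nat_mult (Suc (2 * k)) \<gamma>)" and B = "\<lambda>_. T \<gamma>" and C = "\<lambda>_. T \<gamma>"
            and D = "\<lambda>_. T (nat_mult (Suc (2 * k)) \<gamma> + \<gamma> + \<gamma>)"])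
        (use Suc.IH lin in \<open>auto intro: br_in T_closed\<close>)
    then show ?case
      by (simp add: add_ac)
  qed (use lin in simp)
  then show ?thesis
    unfolding jacobson_sum_eq_poly_int poly_int_def
    by (intro subspace_sum T_subspace) (auto intro: T_closed)
qed

end

theorem theorem3p24:
  fixes p :: nat
    and scale :: "'k::field \<Rightarrow> 'v::ab_group_add \<Rightarrow> 'v"
    and \<epsilon> :: "'g::ab_group_add \<Rightarrow> 'g \<Rightarrow> 'k"
    and T :: "'g \<Rightarrow> 'v set"
    and br :: "'v \<Rightarrow> 'v \<Rightarrow> 'v \<Rightarrow> 'v"
    and J :: "'g \<Rightarrow> 'i set"
    and u v :: "'g \<Rightarrow> 'i \<Rightarrow> 'v"
  assumes "CHAR('k) = p" and "p > 3"
    and "lie_color_triple_system scale \<epsilon> T br"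
    and "\<And>\<gamma>. \<gamma> \<in> G_plus \<epsilon> \<Longrightarrow> vector_space.basis_family scale (J \<gamma>) (u \<gamma>) (T \<gamma>)"
    and "\<And>\<gamma> i. \<gamma> \<in> G_plus \<epsilon> \<Longrightarrow> i \<in> J \<gamma> \<Longrightarrow> v \<gamma> i \<in> T (nat_mult p \<gamma>)"
    and "\<And>\<gamma> i a c. \<gamma> \<in> G_plus \<epsilon> \<Longrightarrow> i \<in> J \<gamma> \<Longrightarrow>
           br a (v \<gamma> i) c = iter_br br (a # replicate p (u \<gamma> i) @ [c])"
  shows "\<exists>!P. restricted_structure p scale \<epsilon> T br P \<and>
           (\<forall>\<gamma>\<in>G_plus \<epsilon>. \<forall>i\<in>J \<gamma>. P \<gamma> (u \<gamma> i) = v \<gamma> i)"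
proof -
  interpret lie_color_triple_system scale \<epsilon> T br by fact
  have prime: "prime p"
    using prime_CHAR_semidom[where ?'a = 'k] assms(1,2) by simp
  then have "odd p"
    using assms(2) prime_odd_nat by auto
  then obtain m where m: "p = Suc (2 * m)"
    by (metis oddE Suc_eq_plus1)
  have module: "lie_triple_module_char scale br (span (multiples \<gamma>)) p m" if "\<gamma> \<in> G_plus \<epsilon>" for \<gamma>
    using that m assms(1)
    by (intro lie_triple_module_char.intro lie_triple_module_multiples lie_triple_module_char_axioms.intro)
      (auto simp: G_plus_def)
  have T_V: "x \<in> span (multiples \<gamma>)" if "x \<in> T \<gamma>" for x \<gamma>
    using that T_subset_multiples by blast
  let ?S = "jacobson_sum scale br p"
  have iter: "iter_br br (a # replicate p y @ [c]) = br (br_pow br y m a) y c" for a y c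
    unfolding m by (rule iter_br_replicate_last)
  have "\<exists>P. (\<forall>x\<in>T \<gamma>. \<forall>y\<in>T \<gamma>. P (x + y) = P x + P y + ?S x y) \<and>
      (\<forall>c. \<forall>x\<in>T \<gamma>. P (scale c x) = scale (c ^ p) (P x)) \<and> (\<forall>i\<in>J \<gamma>. P (u \<gamma> i) = v \<gamma> i)"
    if \<gamma>: "\<gamma> \<in> G_plus \<epsilon>" for \<gamma>
  proof -
    interpret M: lie_triple_module_char scale br "span (multiples \<gamma>)" p m
      using \<gamma> by (rule module)
    show ?thesis
    proof (rule cocycle_trivialization[where S = ?S and v = "v \<gamma>", OF assms(4)[OF \<gamma>] assms(1) prime])
      fix P
      assume "\<And>x y. x \<in> T \<gamma> \<Longrightarrow> y \<in> T \<gamma> \<Longrightarrow> P (x + y) = P x + P y + ?S x y"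
        "\<And>c x. x \<in> T \<gamma> \<Longrightarrow> P (scale c x) = scale (c ^ p) (P x)" "\<And>i. i \<in> J \<gamma> \<Longrightarrow> P (u \<gamma> i) = v \<gamma> i"
      then show ?thesis
        by (intro exI[of _ P]) simp
    qed (rule M.jac_commute M.jac_cocycle M.jac_scale M.jac_collinear T_V; assumption?)+
  qed
  then obtain Q where
    Q_add: "\<And>\<gamma> x y. \<gamma> \<in> G_plus \<epsilon> \<Longrightarrow> x \<in> T \<gamma> \<Longrightarrow> y \<in> T \<gamma> \<Longrightarrow> Q \<gamma> (x + y) = Q \<gamma> x + Q \<gamma> y + ?S x y"
    and Q_scale: "\<And>\<gamma> c x. \<gamma> \<in> G_plus \<epsilon> \<Longrightarrow> x \<in> T \<gamma> \<Longrightarrow> Q \<gamma> (scale c x) = scale (c ^ p) (Q \<gamma> x)"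
    and Q_u: "\<And>\<gamma> i. \<gamma> \<in> G_plus \<epsilon> \<Longrightarrow> i \<in> J \<gamma> \<Longrightarrow> Q \<gamma> (u \<gamma> i) = v \<gamma> i"
    by metis
  \<comment> \<open>Induction along the basis; membership in \<open>T \<gamma>\<close> is kept in
    the hypotheses because the laws for \<open>Q\<close> hold only there.\<close>
  have T_induct: "R x"
    if "\<gamma> \<in> G_plus \<epsilon>" "x \<in> T \<gamma>" "\<And>i. i \<in> J \<gamma> \<Longrightarrow> R (u \<gamma> i)"
      "\<And>c x. x \<in> T \<gamma> \<Longrightarrow> R x \<Longrightarrow> R (scale c x)"
      "\<And>x y. x \<in> T \<gamma> \<Longrightarrow> y \<in> T \<gamma> \<Longrightarrow> R x \<Longrightarrow> R y \<Longrightarrow> R (x + y)" "R 0" for \<gamma> x R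
  proof -
    have span: "span (u \<gamma> ` J \<gamma>) = T \<gamma>"
      using assms(4)[OF that(1)] by (simp add: basis_family_def)
    then have u: "u \<gamma> i \<in> T \<gamma>" if "i \<in> J \<gamma>" for i
      using that span_base by blast
    have "x \<in> span (u \<gamma> ` J \<gamma>)"
      using that span by simp
    then have "x \<in> T \<gamma> \<and> R x"
      by (induction rule: span_induct_alt) (use that u T_closed in auto)
    then show ?thesis ..
  qed
  have Q_0: "Q \<gamma> 0 = 0" if "\<gamma> \<in> G_plus \<epsilon>" for \<gamma>
    using Q_scale[OF that T_closed(1), of 0] m by simp
  have S_in: "?S x y \<in> T (nat_mult p \<gamma>)" if "x \<in> T \<gamma>" "y \<in> T \<gamma>" for x y \<gamma>
    using jacobson_sum_in_T[OF that] unfolding m .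
  have Q_in: "Q \<gamma> x \<in> T (nat_mult p \<gamma>)" if "\<gamma> \<in> G_plus \<epsilon>" "x \<in> T \<gamma>" for \<gamma> x
    using that
    by (rule T_induct)
      (use that(1) in \<open>auto simp: Q_add Q_scale Q_u Q_0 assms(5) intro!: T_closed S_in\<close>)
  \<comment> \<open>On the basis this is the assumption on \<open>v\<close>;
    \<open>M.jac_operator\<close> says that both sides have the same defect of additivity.\<close>
  have Q_br: "\<forall>a c. br a (Q \<gamma> y) c = br (br_pow br y m a) y c" if "\<gamma> \<in> G_plus \<epsilon>" "y \<in> T \<gamma>" for \<gamma> y
  proof -
    interpret M: lie_triple_module_char scale br "span (multiples \<gamma>)" p m
      using that(1) by (rule module)
    show ?thesis
      using that
    proof (rule T_induct)
      fix i assume "i \<in> J \<gamma>"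
      then show "\<forall>a c. br a (Q \<gamma> (u \<gamma> i)) c = br (br_pow br (u \<gamma> i) m a) (u \<gamma> i) c"
        using that assms(6) by (simp add: Q_u iter)
    next
      fix k x assume "x \<in> T \<gamma>" "\<forall>a c. br a (Q \<gamma> x) c = br (br_pow br x m a) x c"
      then show "\<forall>a c. br a (Q \<gamma> (scale k x)) c = br (br_pow br (scale k x) m a) (scale k x) c"
        using that m by (simp add: Q_scale br_linear br_pow_scale mult.commute)
    next
      fix x y assume "x \<in> T \<gamma>" "y \<in> T \<gamma>" "\<forall>a c. br a (Q \<gamma> x) c = br (br_pow br x m a) x c"
        "\<forall>a c. br a (Q \<gamma> y) c = br (br_pow br y m a) y c"
      then show "\<forall>a c. br a (Q \<gamma> (x + y)) c = br (br_pow br (x + y) m a) (x + y) c"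
        using that T_V by (simp add: Q_add br_linear M.jac_operator)
    qed (use that in \<open>simp add: Q_0\<close>)
  qed
  \<comment> \<open>Restriction to the domains gives the extensional family that
    \<open>restricted_structure\<close> asks for.\<close>
  define P where "P = (\<lambda>\<gamma>\<in>G_plus \<epsilon>. \<lambda>x\<in>T \<gamma>. Q \<gamma> x)"
  have uT: "u \<gamma> i \<in> T \<gamma>" if "\<gamma> \<in> G_plus \<epsilon>" "i \<in> J \<gamma>" for \<gamma> i
    using assms(4)[OF that(1)] that(2) span_base unfolding basis_family_def by blast
  show ?thesis
  proof (intro ex1I[of _ P] conjI ballI)
    show "restricted_structure p scale \<epsilon> T br P"
      unfolding restricted_structure_def
    proof (intro conjI ballI allI)
      show "P \<in> (\<Pi>\<^sub>E \<gamma>\<in>G_plus \<epsilon>. T \<gamma> \<rightarrow>\<^sub>E T (nat_mult p \<gamma>))"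
        by (auto simp: P_def Q_in)
    qed (auto simp: P_def T_closed Q_scale Q_add Q_br iter jacobson_sum_def)
    show "P \<gamma> (u \<gamma> i) = v \<gamma> i" if "\<gamma> \<in> G_plus \<epsilon>" "i \<in> J \<gamma>" for \<gamma> i
      using that by (simp add: P_def uT Q_u)
    fix P' assume P': "restricted_structure p scale \<epsilon> T br P' \<and>
        (\<forall>\<gamma>\<in>G_plus \<epsilon>. \<forall>i\<in>J \<gamma>. P' \<gamma> (u \<gamma> i) = v \<gamma> i)"
    then have ext: "P' \<in> (\<Pi>\<^sub>E \<gamma>\<in>G_plus \<epsilon>. T \<gamma> \<rightarrow>\<^sub>E T (nat_mult p \<gamma>))"
      and P'_scale: "\<And>\<gamma> c x. \<gamma> \<in> G_plus \<epsilon> \<Longrightarrow> x \<in> T \<gamma> \<Longrightarrow> P' \<gamma> (scale c x) = scale (c ^ p) (P' \<gamma> x)"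
      and P'_add: "\<And>\<gamma> x y. \<gamma> \<in> G_plus \<epsilon> \<Longrightarrow> x \<in> T \<gamma> \<Longrightarrow> y \<in> T \<gamma> \<Longrightarrow>
        P' \<gamma> (x + y) = P' \<gamma> x + P' \<gamma> y + ?S x y"
      by (auto simp: restricted_structure_def jacobson_sum_def)
    have P'_0: "P' \<gamma> 0 = 0" if "\<gamma> \<in> G_plus \<epsilon>" for \<gamma>
      using P'_scale[OF that T_closed(1), of 0] m by simp
    \<comment> \<open>Both families obey the same addition and scalar laws, so agreement spreads
      from the basis to all of \<open>T \<gamma>\<close>.\<close>
    have eq: "P' \<gamma> x = Q \<gamma> x" if "\<gamma> \<in> G_plus \<epsilon>" "x \<in> T \<gamma>" for \<gamma> x
      using that
      by (rule T_induct) (use that(1) P' in \<open>auto simp: P'_scale P'_add P'_0 Q_scale Q_add Q_0 Q_u\<close>)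
    show "P' = P"
    proof
      fix \<gamma>
      show "P' \<gamma> = P \<gamma>"
      proof (cases "\<gamma> \<in> G_plus \<epsilon>")
        case True
        then have "P' \<gamma> \<in> T \<gamma> \<rightarrow>\<^sub>E T (nat_mult p \<gamma>)"
          using ext by (rule PiE_mem[rotated])
        then show ?thesis
          using True eq by (auto simp: P_def PiE_def extensional_def)
      qed (use ext in \<open>auto simp: P_def PiE_def extensional_def\<close>)
    qed
  qed
qed

end
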